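(* In types $E_6^{(1)}$ and $E_7^{(1)}$, each Young wall in $\mathcal Z(\Lambda_0)$ satisfies the right block property: if the wall contains a block, then it contains the block occupying the same position in the column immediately to the right (i.e. if it contains a block of column $r+1$, it contains the block in the same position of column $r$, for all $r\ge0$).
   Context: **Notation.** $\hat{\mathfrak g}$ is the untwisted affine Kac–Moody algebra of type $E_6^{(1)}$ or $E_7^{(1)}$, with index set $I=\{0,\dots,n\}$ ($n=6,7$) and fundamental weights $\Lambda_i$. Dynkin diagrams (Bourbaki): $E_6^{(1)}$: chain $1-3-4-5-6$ together with $4-2-0$; $E_7^{(1)}$: chain $0-1-3-4-5-6-7$ together with $4-2$. **Crystals.** On a tensor product of crystals: $\tilde f_i(b\otimes b')=\tilde f_ib\otimes b'$ if $\varphi_i(b)>\varepsilon_i(b')$ and $b\otimes\tilde f_ib'$ otherwise; $\tilde e_i(b\otimes b')=\tilde e_ib\otimes b'$ if $\varphi_i(b)\ge\varepsilon_i(b')$ and $b\otimes\tilde e_ib'$ otherwise. The affinization of a classical crystal $C$ is $C_{\mathrm{aff}}=\{z^mc:m\in\mathbb Z,c\in C\}$ with $\tilde e_i(z^mc)=z^{m+\delta_{i0}}\tilde e_ic$, $\tilde f_i(z^mc)=z^{m-\delta_{i0}}\tilde f_ic$, and $\varepsilon_i,\varphi_i$ as for $c$. **Young column patterns.** An infinite vertical strip of unit cubes indexed by $k\in\mathbb Z$ (height increasing with $k$), each cut by vertical cuts into blocks coloured by $I$. The horizontal cross-section of every cube is a grid with $w$ columns of cells (numbered $1,\dots,w$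 from left to right) and two rows (upper, lower), $w=2$ for $E_6^{(1)}$ and $w=3$ for $E_7^{(1)}$. A block is the full-height prism over a union of cells. Write $u/l$ for a cross-section whose upper row has colours $u$ and lower row has colours $l$ (just $u$ if both rows agree); equally coloured cells of one cube form a single block. Rotation by $180^\circ$ sends $u/l$ to $\mathrm{rev}(l)/\mathrm{rev}(u)$, where rev reverses a word. - $E_6^{(1)}$ (period 12): cubes $1,\dots,6$ are $44/04$; $25$; $46/44$; $35$; $44/14$; $32$; cube $k+6$ is the rotation of cube $k$ for all $k$. - $E_7^{(1)}$ (period 8): cubes $1,\dots,8$ are $332/032$; $144$; $355/335$; $446$; $257/255$; $446$; $355/335$; $144$. **Young columns.** A Young column is a nonempty collection of blocks of the pattern of bounded height with no empty space below any block: if a block of cube $k$ belongs to it, so does every block of cube $k-1$ lying below at least one of its cells. Young columns are equivalent if obtained from one another by vertical translation and/or rotation by $180^\circ$ about the vertical axis. An $i$-block of a Young column is removable if removing it leaves a Young column; an $i$-block not in it is addable if adding it gives a Young column. $\tilde f_i$ adds an addable $i$-block if one exists and gives $0$ otherwise; $\tilde e_i$ removes a removable $i$-block if one exists and gives $0$ otherwise; $\varphi_i(y)=\max\{m:\tilde f_i^my\ne0\}$, $\varepsilon_i(y)=\max\{m:\tilde e_i^my\ne0\}$. The set $C$ of equivalence classes becomes a classical crystal with $\mathrm{wt}(y)=\sum_i(\varphi_i(y)-\varepsilon_i(y))\Lambda_i$. **Energy functions.** $H:C\otimes C\to\mathbb Z$ is the function with $H(\tilde f_i(b\otimes b'))=H(b\otimes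 b')$ for $i\ne0$, and, when $\tilde f_0(b\otimes b')\neq0$, $H(\tilde f_0(b\otimes b'))=H(b\otimes b')+1$ if $\tilde f_0(b\otimes b')=\tilde f_0b\otimes b'$ and $H(b\otimes b')-1$ if $\tilde f_0(b\otimes b')=b\otimes\tilde f_0b'$; normalised by $H(c\otimes c)=0$ for all $c\in C$. $H_{\mathrm{aff}}(z^ma\otimes z^nb)=H(a\otimes b)+m-n$. **Young walls.** The Young wall pattern has columns indexed $r=0,1,2,\dots$ from right to left. In type $E_6^{(1)}$, cube $k$ of column $r$ is cube $k+8r$ of the Young column pattern; in type $E_7^{(1)}$, column $r$ is the Young column pattern for $r$ even, and for $r$ odd its cube $k$ is the rotation of cube $k+4$ of the Young column pattern. Each column pattern is thus a translated/rotated copy of the Young column pattern, so Young columns in column $r$, their classes in $C$ and the operators $\tilde e_i,\tilde f_i$ make sense; the positions of the blocks (not their colours) are the same in all columns. The ground state wall consists in every column $r$ of all blocks of cubes $k\le0$ together with: ($E_6^{(1)}$) the three-cell block of cube 1, the block over cell column 2 of cube 2, the one-cell block of cube 3; ($E_7^{(1)}$) all blocks of cube 1 except the one-cell block, the block over cell columns 2–3 of cube 2, the block of cube 3 containing cell column 3, the block over cell column 3 of cube 4, the one-cell block of cube 5. Let $b_r\in C$ be the class of column $r$ of the ground state wall, and let $m_r\in\mathbb Z$ be given by $m_0=0$ and $H_{\mathrm{aff}}(z^{m_{r+1}}b_{r+1}\otimes z^{m_r}b_r)=1$ for all $r\ge0$. A Young wall is a collection of blocks of the Young wall pattern which differs from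 the ground state wall in finitely many blocks and each of whose columns is a Young column. The Young columns in column $r$ are identified with the elements $z^my$ of $C_{\mathrm{aff}}$ by the bijection commuting with all $\tilde e_i,\tilde f_i$ which sends column $r$ of the ground state wall to $z^{m_r}b_r$; so a Young wall is written $(z^{n_r}y_r)_{r\ge0}$. $\mathcal Z(\Lambda_0)$ is the set of Young walls $(z^{n_r}y_r)_{r\ge0}$ with $H_{\mathrm{aff}}(z^{n_{r+1}}y_{r+1}\otimes z^{n_r}y_r)>0$ for all $r\ge0$. *)

theory Defs
  imports Main
begin

text \<open>
  Young columns and Young walls of types \<open>E\<^sub>6\<^sup>(\<^sup>1\<^sup>)\<close> and \<open>E\<^sub>7\<^sup>(\<^sup>1\<^sup>)\<close>. Partial maps into \<open>option\<close> encode
  crystal operators; \<open>None\<close> is the element 0 of the crystal literature.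
\<close>

datatype affine_type = E6 | E7

fun rank_of :: "affine_type \<Rightarrow> nat" where
  "rank_of E6 = 6"
| "rank_of E7 = 7"

definition index_set :: "affine_type \<Rightarrow> nat set" where
  "index_set X = {0..rank_of X}"


section \<open>Patterns\<close>

text \<open>A cross-section \<open>u/l\<close> of a cube is the pair \<open>(u, l)\<close> of its rows of colours; a pattern
  assigns to the cube of each height its cross-section.\<close>

type_synonym cross_section = "nat list \<times> nat list"
type_synonym pattern = "int \<Rightarrow> cross_section"

definition turn_section :: "cross_section \<Rightarrow> cross_section" where
  "turn_section s = (rev (snd s), rev (fst s))"

fun width :: "affine_type \<Rightarrow> nat" where
  "width E6 = 2"
| "width E7 = 3"

text \<open>The listed cubes of one (half) period, starting with cube 1 at list position 0.\<close>

fun listed_cubes :: "affine_type \<Rightarrow> cross_section list" where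
  "listed_cubes E6 =
    [([4,4],[0,4]), ([2,5],[2,5]), ([4,6],[4,4]), ([3,5],[3,5]), ([4,4],[1,4]), ([3,2],[3,2])]"
| "listed_cubes E7 =
    [([3,3,2],[0,3,2]), ([1,4,4],[1,4,4]), ([3,5,5],[3,3,5]), ([4,4,6],[4,4,6]),
     ([2,5,7],[2,5,5]), ([4,4,6],[4,4,6]), ([3,5,5],[3,3,5]), ([1,4,4],[1,4,4])]"

fun column_pattern :: "affine_type \<Rightarrow> pattern" where
  "column_pattern E6 k =
    (let q = nat ((k - 1) mod 12) in
     if q < 6 then listed_cubes E6 ! q else turn_section (listed_cubes E6 ! (q - 6)))"
| "column_pattern E7 k = listed_cubes E7 ! nat ((k - 1) mod 8)"

fun wall_pattern :: "affine_type \<Rightarrow> nat \<Rightarrow> pattern" where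
  "wall_pattern E6 r k = column_pattern E6 (k + 8 * int r)"
| "wall_pattern E7 r k =
    (if even r then column_pattern E7 k else turn_section (column_pattern E7 (k + 4)))"

datatype row = Upper | Lower

text \<open>A cell is given by its column number, counted from 1, and its row.\<close>

type_synonym cell = "nat \<times> row"

definition cells :: "affine_type \<Rightarrow> cell set" where
  "cells X = {1..width X} \<times> UNIV"

fun cell_colour :: "cross_section \<Rightarrow> cell \<Rightarrow> nat" where
  "cell_colour s (j, Upper) = fst s ! (j - 1)"
| "cell_colour s (j, Lower) = snd s ! (j - 1)"

text \<open>A block is given by its position only: the height of its cube and the cells it occupies.
  Its colour is read off from the pattern, so blocks at the same position in different columns
  of a wall are equal as values of type \<open>block\<close>.\<close>

type_synonym block = "int \<times> cell set"

definition is_colour_block :: "affine_type \<Rightarrow> pattern \<Rightarrow> nat \<Rightarrow> block \<Rightarrow> bool" where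
  "is_colour_block X P i b \<longleftrightarrow>
     snd b = {c \<in> cells X. cell_colour (P (fst b)) c = i} \<and> snd b \<noteq> {}"

definition is_block :: "affine_type \<Rightarrow> pattern \<Rightarrow> block \<Rightarrow> bool" where
  "is_block X P b \<longleftrightarrow> (\<exists>i. is_colour_block X P i b)"


section \<open>Young columns\<close>

definition young_column :: "affine_type \<Rightarrow> pattern \<Rightarrow> block set \<Rightarrow> bool" where
  "young_column X P y \<longleftrightarrow>
     y \<noteq> {} \<and>
     (\<forall>b\<in>y. is_block X P b) \<and>
     (\<exists>h. \<forall>b\<in>y. fst b \<le> h) \<and>
     (\<forall>k S S'. (k, S) \<in> y \<and> is_block X P (k - 1, S') \<and> S \<inter> S' \<noteq> {} \<longrightarrow> (k - 1, S') \<in> y)"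

definition addable :: "affine_type \<Rightarrow> pattern \<Rightarrow> nat \<Rightarrow> block set \<Rightarrow> block \<Rightarrow> bool" where
  "addable X P i y b \<longleftrightarrow> is_colour_block X P i b \<and> b \<notin> y \<and> young_column X P (insert b y)"

definition removable :: "affine_type \<Rightarrow> pattern \<Rightarrow> nat \<Rightarrow> block set \<Rightarrow> block \<Rightarrow> bool" where
  "removable X P i y b \<longleftrightarrow> is_colour_block X P i b \<and> b \<in> y \<and> young_column X P (y - {b})"

text \<open>A Young column has at most one addable and at most one removable \<open>i\<close>-block for each \<open>i\<close>,
  so the choices below are forced.\<close>

definition f_col :: "affine_type \<Rightarrow> pattern \<Rightarrow> nat \<Rightarrow> block set \<Rightarrow> block set option" where
  "f_col X P i y =
     (if \<exists>b. addable X P i y b then Some (insert (SOME b. addable X P i y b) y) else None)"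

definition e_col :: "affine_type \<Rightarrow> pattern \<Rightarrow> nat \<Rightarrow> block set \<Rightarrow> block set option" where
  "e_col X P i y =
     (if \<exists>b. removable X P i y b then Some (y - {SOME b. removable X P i y b}) else None)"

text \<open>A motion \<open>(t, \<rho>)\<close> is the translation by \<open>t\<close> upwards, composed with the rotation by 180
  degrees about the vertical axis if \<open>\<rho>\<close> holds.\<close>

type_synonym motion = "int \<times> bool"

fun turn_cell :: "affine_type \<Rightarrow> cell \<Rightarrow> cell" where
  "turn_cell X (j, Upper) = (width X + 1 - j, Lower)"
| "turn_cell X (j, Lower) = (width X + 1 - j, Upper)"

definition move_block :: "affine_type \<Rightarrow> motion \<Rightarrow> block \<Rightarrow> block" where
  "move_block X g b = (fst b + fst g, if snd g then turn_cell X ` snd b else snd b)"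

text \<open>The motion \<open>g\<close> maps the pattern \<open>P\<close>, with its colours, onto the Young column pattern.\<close>

definition to_column_pattern :: "affine_type \<Rightarrow> pattern \<Rightarrow> motion \<Rightarrow> bool" where
  "to_column_pattern X P g \<longleftrightarrow>
     (\<forall>k. column_pattern X (k + fst g) = (if snd g then turn_section (P k) else P k))"

text \<open>The class of a Young column in any pattern which is a translated and/or rotated copy of the
  Young column pattern, as a set of Young columns in the latter. For \<open>P = column_pattern X\<close> this
  is the equivalence class of \<open>y\<close>.\<close>

definition class_of :: "affine_type \<Rightarrow> pattern \<Rightarrow> block set \<Rightarrow> block set set" where
  "class_of X P y = {move_block X g ` y | g. to_column_pattern X P g}"


section \<open>The classical crystal, its tensor square and its affinization\<close>

type_synonym yclass = "block set set"

definition crystal :: "affine_type \<Rightarrow> yclass set" where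
  "crystal X = class_of X (column_pattern X) ` {y. young_column X (column_pattern X) y}"

text \<open>Motions preserving the Young column pattern commute with adding and removing \<open>i\<close>-blocks, so
  the operators on classes do not depend on the representative.\<close>

definition f_cls :: "affine_type \<Rightarrow> nat \<Rightarrow> yclass \<Rightarrow> yclass option" where
  "f_cls X i c =
     map_option (class_of X (column_pattern X)) (f_col X (column_pattern X) i (SOME y. y \<in> c))"

definition e_cls :: "affine_type \<Rightarrow> nat \<Rightarrow> yclass \<Rightarrow> yclass option" where
  "e_cls X i c =
     map_option (class_of X (column_pattern X)) (e_col X (column_pattern X) i (SOME y. y \<in> c))"

definition string_length :: "('a \<Rightarrow> 'a option) \<Rightarrow> 'a \<Rightarrow> nat" where
  "string_length op x = Max {m. ((\<lambda>z. Option.bind z op) ^^ m) (Some x) \<noteq> None}"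

definition phi :: "affine_type \<Rightarrow> nat \<Rightarrow> yclass \<Rightarrow> nat" where
  "phi X i c = string_length (f_cls X i) c"

definition eps :: "affine_type \<Rightarrow> nat \<Rightarrow> yclass \<Rightarrow> nat" where
  "eps X i c = string_length (e_cls X i) c"

definition f_tensor :: "affine_type \<Rightarrow> nat \<Rightarrow> yclass \<times> yclass \<Rightarrow> (yclass \<times> yclass) option" where
  "f_tensor X i = (\<lambda>(b, b').
     if phi X i b > eps X i b' then map_option (\<lambda>d. (d, b')) (f_cls X i b)
     else map_option (\<lambda>d. (b, d)) (f_cls X i b'))"

definition f_aff :: "affine_type \<Rightarrow> nat \<Rightarrow> int \<times> yclass \<Rightarrow> (int \<times> yclass) option" where
  "f_aff X i = (\<lambda>(m, c). map_option (\<lambda>d. (m - (if i = 0 then 1 else 0), d)) (f_cls X i c))"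

definition e_aff :: "affine_type \<Rightarrow> nat \<Rightarrow> int \<times> yclass \<Rightarrow> (int \<times> yclass) option" where
  "e_aff X i = (\<lambda>(m, c). map_option (\<lambda>d. (m + (if i = 0 then 1 else 0), d)) (e_cls X i c))"


section \<open>Energy functions\<close>

definition is_energy :: "affine_type \<Rightarrow> (yclass \<times> yclass \<Rightarrow> int) \<Rightarrow> bool" where
  "is_energy X H \<longleftrightarrow>
     (\<forall>i\<in>index_set X. \<forall>b\<in>crystal X. \<forall>b'\<in>crystal X. \<forall>p.
        i \<noteq> 0 \<and> f_tensor X i (b, b') = Some p \<longrightarrow> H p = H (b, b')) \<and>
     (\<forall>b\<in>crystal X. \<forall>b'\<in>crystal X. \<forall>d.
        f_tensor X 0 (b, b') = Some (d, b') \<and> f_cls X 0 b = Some d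
          \<longrightarrow> H (d, b') = H (b, b') + 1) \<and>
     (\<forall>b\<in>crystal X. \<forall>b'\<in>crystal X. \<forall>d.
        f_tensor X 0 (b, b') = Some (b, d) \<and> f_cls X 0 b' = Some d
          \<longrightarrow> H (b, d) = H (b, b') - 1) \<and>
     (\<forall>c\<in>crystal X. H (c, c) = 0)"

text \<open>The conditions determine \<open>H\<close> on pairs of elements of the crystal; the choice only
  affects its values elsewhere.\<close>

definition energy :: "affine_type \<Rightarrow> yclass \<times> yclass \<Rightarrow> int" where
  "energy X = (SOME H. is_energy X H)"

definition energy_aff :: "affine_type \<Rightarrow> int \<times> yclass \<Rightarrow> int \<times> yclass \<Rightarrow> int" where
  "energy_aff X = (\<lambda>(m, a) (n, b). energy X (a, b) + m - n)"


section \<open>Young walls\<close>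

text \<open>A wall is given by its sequence of columns, indexed from right to left.\<close>

type_synonym wall = "nat \<Rightarrow> block set"

fun ground_shape :: "affine_type \<Rightarrow> block \<Rightarrow> bool" where
  "ground_shape E6 (k, S) \<longleftrightarrow>
     k \<le> 0 \<or> k = 1 \<and> card S = 3 \<or> k = 2 \<and> S = {2} \<times> UNIV \<or> k = 3 \<and> card S = 1"
| "ground_shape E7 (k, S) \<longleftrightarrow>
     k \<le> 0 \<or> k = 1 \<and> card S \<noteq> 1 \<or> k = 2 \<and> S = {2, 3} \<times> UNIV \<or> k = 3 \<and> {3} \<times> UNIV \<subseteq> S \<or>
     k = 4 \<and> S = {3} \<times> UNIV \<or> k = 5 \<and> card S = 1"

definition ground_wall :: "affine_type \<Rightarrow> wall" where
  "ground_wall X r = {b. is_block X (wall_pattern X r) b \<and> ground_shape X b}"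

definition young_wall :: "affine_type \<Rightarrow> wall \<Rightarrow> bool" where
  "young_wall X Y \<longleftrightarrow>
     (\<forall>r. young_column X (wall_pattern X r) (Y r)) \<and>
     finite {(r, b). (b \<in> Y r) \<noteq> (b \<in> ground_wall X r)}"

definition ground_class :: "affine_type \<Rightarrow> nat \<Rightarrow> yclass" where
  "ground_class X r = class_of X (wall_pattern X r) (ground_wall X r)"

primrec ground_height :: "affine_type \<Rightarrow> nat \<Rightarrow> int" where
  "ground_height X 0 = 0"
| "ground_height X (Suc r) =
     ground_height X r + 1 - energy X (ground_class X (Suc r), ground_class X r)"

text \<open>The recursion solves the defining condition on consecutive columns of the ground state wall.\<close>

lemma ground_height_iff:
  "m = ground_height X \<longleftrightarrow>
     m 0 = 0 \<and>
     (\<forall>r. energy_aff X (m (Suc r), ground_class X (Suc r)) (m r, ground_class X r) = 1)"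
  (is "?L \<longleftrightarrow> ?R")
proof
  assume ?L
  then show ?R by (simp add: energy_aff_def)
next
  assume R: ?R
  have "m r = ground_height X r" for r
  proof (induction r)
    case 0
    show ?case using R by simp
  next
    case (Suc r)
    have "energy_aff X (m (Suc r), ground_class X (Suc r)) (m r, ground_class X r) = 1"
      using R by blast
    then show ?case using Suc.IH by (simp add: energy_aff_def)
  qed
  then show ?L by (rule ext)
qed

definition is_identification ::
    "affine_type \<Rightarrow> nat \<Rightarrow> (block set \<Rightarrow> int \<times> yclass) \<Rightarrow> bool" where
  "is_identification X r \<psi> \<longleftrightarrow>
     bij_betw \<psi> {y. young_column X (wall_pattern X r) y} (UNIV \<times> crystal X) \<and>
     (\<forall>i\<in>index_set X. \<forall>y. young_column X (wall_pattern X r) y \<longrightarrow>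
        map_option \<psi> (f_col X (wall_pattern X r) i y) = f_aff X i (\<psi> y) \<and>
        map_option \<psi> (e_col X (wall_pattern X r) i y) = e_aff X i (\<psi> y)) \<and>
     \<psi> (ground_wall X r) = (ground_height X r, ground_class X r)"

text \<open>The conditions determine \<open>\<psi>\<close> on the Young columns in column \<open>r\<close>; the choice only
  affects its values elsewhere.\<close>

definition identification :: "affine_type \<Rightarrow> nat \<Rightarrow> block set \<Rightarrow> int \<times> yclass" where
  "identification X r = (SOME \<psi>. is_identification X r \<psi>)"

definition Z_Lambda0 :: "affine_type \<Rightarrow> wall set" where
  "Z_Lambda0 X = {Y. young_wall X Y \<and>
     (\<forall>r. energy_aff X (identification X (Suc r) (Y (Suc r))) (identification X r (Y r)) > 0)}"

text \<open>Equality of blocks being equality of positions, this compares each column with its right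
  neighbour position by position.\<close>

definition right_block_property :: "wall \<Rightarrow> bool" where
  "right_block_property Y \<longleftrightarrow> (\<forall>r b. b \<in> Y (Suc r) \<longrightarrow> b \<in> Y r)"

end

theory Submission
  imports Defs
begin

text \<open>
  The pattern has a colour-preserving motion \<open>\<tau>\<close> which adds one null root to every column,
  and two columns have the same class iff they differ by a power of \<open>\<tau>\<close>. The
  affine energy of columns \<open>a\<close>, \<open>b\<close> is the least \<open>k\<close> with \<open>b \<subseteq> \<tau>\<^sup>k a\<close>: in an order ideal, the
    maximal
  blocks and the minimal missing blocks are governed by the tensor product rule, which makes this
  number invariant, and \<open>C \<otimes> C\<close> is connected up to diagonal pairs, which makes it the only choice.

  Blocks keep their positions, but not their colours, from one column of a wall to the next, and the
  shape of the pattern is preserved by a motion \<open>\<sigma>\<close> shorter than \<open>\<tau>\<close>. In terms of positions the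
  condition of positive energy on neighbouring columns \<open>y'\<close> (left) and \<open>y\<close> (right) becomes
  \<open>\<not> y \<subseteq> \<sigma> y'\<close>. Since any two blocks satisfy \<open>b \<le> \<sigma> d\<close> or \<open>d \<le> b\<close>, a block \<open>b\<close> of \<open>y'\<close> missing
  in \<open>y\<close> would force \<open>y \<subseteq> \<sigma> y'\<close>.
\<close>

section \<open>Finite checks on one period\<close>

text \<open>The blocks form a heap over the affine Dynkin diagram: covers join adjacent colours, and
  blocks of equal or adjacent colours are comparable. Hence a column has at most one addable or
  removable block of each colour, and never both, so all \<open>i\<close>-strings have length at
  most one and the tensor product rule becomes a statement about single blocks.

  \<open>energy\<close> and \<open>identification\<close> are defined by choice, so a solution is
  not enough: both must be shown unique. For the energy the obstacle is that the tensor product rule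
  dictates which factor moves, so a pair cannot be reduced one column at a time. Blocks are instead
  removed from both columns together until both are ideals generated by a 0-block; these are
  translates of each other and fall under the normalisation.

  Neighbouring columns are displaced by 8 = 6 + 2 in \<open>E6\<close> and by 4 = 0 + 4 in
  \<open>E7\<close>; splitting off a power of \<tau> leaves \<sigma>, whence its heights 2 and 4.
  The ground state wall is not contained in its own image under \<sigma>, since its topmost block is
  the image of the one-cell block that it lacks in cube 1; this turns positive energy into a
  non-inclusion.\<close>

fun period :: "affine_type \<Rightarrow> nat" where
  "period E6 = 12"
| "period E7 = 8"

fun sections :: "affine_type \<Rightarrow> cross_section list" where
  "sections E6 = listed_cubes E6 @ map turn_section (listed_cubes E6)"
| "sections E7 = listed_cubes E7"

definition section_at :: "affine_type \<Rightarrow> nat \<Rightarrow> cross_section" where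
  "section_at X q = sections X ! (q mod period X)"

definition phase :: "affine_type \<Rightarrow> int \<Rightarrow> nat" where
  "phase X k = nat ((k - 1) mod int (period X))"

lemma period_pos [simp]: "0 < period X"
  by (cases X) auto

lemma phase_less: "phase X k < period X"
  by (simp add: phase_def nat_less_iff)

lemma column_pattern_phase: "column_pattern X k = section_at X (phase X k)"
proof (cases X)
  case E6
  have len: "length (listed_cubes E6) = 6" by simp
  have "nat ((k - 1) mod 12) < 12" by (simp add: nat_less_iff)
  then show ?thesis
    by (simp add: E6 section_at_def phase_def Let_def nth_append len del: listed_cubes.simps)
next
  case E7
  have "nat ((k - 1) mod 8) < 8" by (simp add: nat_less_iff)
  then show ?thesis
    by (auto simp: E7 section_at_def phase_def)
qed

lemma column_pattern_add: "column_pattern X (k + int n) = section_at X (phase X k + n)"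
proof -
  have "int (phase X (k + int n)) = (k + int n - 1) mod int (period X)"
    by (simp add: phase_def)
  also have "\<dots> = ((k - 1) mod int (period X) + int n) mod int (period X)"
    by (simp add: mod_simps algebra_simps)
  also have "\<dots> = int ((phase X k + n) mod period X)"
    by (simp add: phase_def zmod_int)
  finally have "phase X (k + int n) = (phase X k + n) mod period X"
    by simp
  then show ?thesis
    by (simp add: column_pattern_phase section_at_def)
qed

fun cell_list :: "affine_type \<Rightarrow> cell list" where
  "cell_list E6 = [(1, Upper), (2, Upper), (1, Lower), (2, Lower)]"
| "cell_list E7 = [(1, Upper), (2, Upper), (3, Upper), (1, Lower), (2, Lower), (3, Lower)]"

lemma UNIV_row: "UNIV = {Upper, Lower}"
  using row.exhaust by auto

lemma cells_eq: "cells X = set (cell_list X)"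
proof -
  have "{1..2::nat} = {1, 2}" "{1..3::nat} = {1, 2, 3}" by auto
  then show ?thesis
    by (cases X) (auto simp: cells_def UNIV_row)
qed

text \<open>The affine Dynkin diagram. Blocks of distinct non-adjacent colours may be incomparable,
  so the checks have to know it.\<close>

fun edges :: "affine_type \<Rightarrow> (nat \<times> nat) list" where
  "edges E6 = [(1,3), (3,4), (4,5), (5,6), (2,4), (0,2)]"
| "edges E7 = [(0,1), (1,3), (3,4), (4,5), (5,6), (6,7), (2,4)]"

definition adjacent :: "affine_type \<Rightarrow> nat \<Rightarrow> nat \<Rightarrow> bool" where
  "adjacent X i j \<longleftrightarrow> (i, j) \<in> set (edges X) \<or> (j, i) \<in> set (edges X)"

definition colours :: "affine_type \<Rightarrow> cross_section \<Rightarrow> nat list" where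
  "colours X s = map (cell_colour s) (cell_list X)"

text \<open>A literal table of the colours of the sections, so that the checks below evaluate quickly.\<close>

fun words :: "affine_type \<Rightarrow> nat list list" where
  "words E6 =
    [[4,4,0,4], [2,5,2,5], [4,6,4,4], [3,5,3,5], [4,4,1,4], [3,2,3,2],
     [4,0,4,4], [5,2,5,2], [4,4,6,4], [5,3,5,3], [4,1,4,4], [2,3,2,3]]"
| "words E7 =
    [[3,3,2,0,3,2], [1,4,4,1,4,4], [3,5,5,3,3,5], [4,4,6,4,4,6],
     [2,5,7,2,5,5], [4,4,6,4,4,6], [3,5,5,3,3,5], [1,4,4,1,4,4]]"

definition word :: "affine_type \<Rightarrow> nat \<Rightarrow> nat list" where
  "word X q = words X ! (q mod period X)"

lemma words_eq: "map (colours X) (sections X) = words X"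
  by (cases X) (simp_all add: colours_def turn_section_def)

lemma word_eq: "word X q = colours X (section_at X q)"
proof -
  have "q mod period X < length (sections X)"
    by (cases X) auto
  then show ?thesis
    by (simp add: word_def section_at_def flip: words_eq)
qed

section \<open>Finite checks for the order on blocks and for \<sigma>\<close>

fun rise :: "nat list \<Rightarrow> (nat \<times> nat) list \<Rightarrow> nat list" where
  "rise S [] = []"
| "rise S ((a, b) # ps) = (if b \<in> set S then List.insert a (rise S ps) else rise S ps)"

text \<open>\<open>ascent X q i n\<close> lists the colours of the blocks \<open>n\<close> cubes above the \<open>i\<close>-block of a cube
  of phase \<open>q\<close> which rest, directly or indirectly, on that block.\<close>

fun ascent :: "affine_type \<Rightarrow> nat \<Rightarrow> nat \<Rightarrow> nat \<Rightarrow> nat list" where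
  "ascent X q i 0 = [i]"
| "ascent X q i (Suc n) = rise (ascent X q i n) (zip (word X (q + Suc n)) (word X (q + n)))"

text \<open>Blocks whose heights differ by at least \<open>span X\<close> are comparable.\<close>

fun span :: "affine_type \<Rightarrow> nat" where
  "span E6 = 3"
| "span E7 = 5"

text \<open>The motion \<open>\<sigma>\<close> goes up by \<open>lift X\<close> and rotates.\<close>

fun lift :: "affine_type \<Rightarrow> nat" where
  "lift E6 = 2"
| "lift E7 = 4"

text \<open>The finite checks are stated without bound variables, because \<open>code_simp\<close> rewrites under
  abstractions and would unfold the recursions there.\<close>

definition comparable_at :: "affine_type \<Rightarrow> nat \<Rightarrow> bool \<Rightarrow> nat list \<Rightarrow> nat \<Rightarrow> bool" where
  "comparable_at X i far S j \<longleftrightarrow> (i = j \<or> adjacent X i j \<or> far \<longrightarrow> j \<in> set S)"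

text \<open>At \<open>n = 0\<close> the ascent is just \<open>[i]\<close>, so the check says that no
  cube contains two adjacent colours. At \<open>n = span X\<close> every colour is tested, which
  makes all blocks at that distance comparable.\<close>

definition comparable_above :: "affine_type \<Rightarrow> nat \<Rightarrow> nat \<Rightarrow> nat \<Rightarrow> bool" where
  "comparable_above X q n i \<longleftrightarrow>
     list_all (comparable_at X i (n = span X) (ascent X q i n)) (word X (q + n))"

definition comparable_level :: "affine_type \<Rightarrow> nat \<Rightarrow> nat \<Rightarrow> bool" where
  "comparable_level X q n \<longleftrightarrow> list_all (comparable_above X q n) (remdups (word X q))"

text \<open>\<open>p\<close> pairs the colour of a block \<open>d\<close> of phase \<open>q\<close>
  with that of its image under \<sigma>, and \<open>S\<close> collects the colours at the height of
  this image that rest on the \<open>i\<close>-block \<open>b\<close>, \<open>m\<close> cubes above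
  \<open>d\<close>. The alternatives are thus \<open>b\<close> below \<sigma> \<open>d\<close>, and
  \<open>d\<close> below \<open>b\<close>.\<close>

definition lift_at :: "affine_type \<Rightarrow> nat \<Rightarrow> nat \<Rightarrow> nat \<Rightarrow> nat list \<Rightarrow> nat \<times> nat \<Rightarrow> bool" where
  "lift_at X q m i S p \<longleftrightarrow> snd p \<in> set S \<or> i \<in> set (ascent X q (fst p) m)"

definition lift_above :: "affine_type \<Rightarrow> nat \<Rightarrow> nat \<Rightarrow> nat \<Rightarrow> bool" where
  "lift_above X q m i \<longleftrightarrow>
     list_all (lift_at X q m i (ascent X (q + m) i (lift X - m)))
       (remdups (zip (rev (word X q)) (word X (q + lift X))))"

definition lift_level :: "affine_type \<Rightarrow> nat \<Rightarrow> nat \<Rightarrow> bool" where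
  "lift_level X q m \<longleftrightarrow> list_all (lift_above X q m) (remdups (word X (q + m)))"

text \<open>The pairs that occur are the graph of a bijection of colours, so two cells agree in
  colour in one word iff they do in the other: both words cut the cube into the same blocks.\<close>

definition same_partition :: "nat list \<Rightarrow> nat list \<Rightarrow> bool" where
  "same_partition u v \<longleftrightarrow>
     distinct (map fst (remdups (zip u v))) \<and> distinct (map snd (remdups (zip u v)))"

text \<open>In this order: stacked cells have adjacent colours; comparability in the heap; the
  alternative \<open>b\<close> below \<sigma> \<open>d\<close> or \<open>d\<close> below
  \<open>b\<close>, for the heights of \<open>b\<close> that distance alone does not settle; and
  \<sigma> preserves the cuts.\<close>

definition phase_check :: "affine_type \<Rightarrow> nat \<Rightarrow> bool" where
  "phase_check X q \<longleftrightarrow>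
     list_all2 (adjacent X) (word X (Suc q)) (word X q) \<and>
     list_all (comparable_level X q) [0..<Suc (span X)] \<and>
     list_all (lift_level X q) [0..<span X] \<and>
     same_partition (rev (word X q)) (word X (q + lift X))"

lemma phase_check_E6: "list_all (phase_check E6) [0..<12]"
  by code_simp

lemma phase_check_E7: "list_all (phase_check E7) [0..<8]"
  by code_simp

lemma phase_check: "q < period X \<Longrightarrow> phase_check X q"
  using phase_check_E6 phase_check_E7 by (cases X) (simp_all add: list_all_iff)

section \<open>The order on blocks\<close>

abbreviation colour_block :: "affine_type \<Rightarrow> nat \<Rightarrow> block \<Rightarrow> bool" where
  "colour_block X \<equiv> is_colour_block X (column_pattern X)"

abbreviation column_block :: "affine_type \<Rightarrow> block \<Rightarrow> bool" where
  "column_block X \<equiv> is_block X (column_pattern X)"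

abbreviation column :: "affine_type \<Rightarrow> block set \<Rightarrow> bool" where
  "column X \<equiv> young_column X (column_pattern X)"

definition cover :: "affine_type \<Rightarrow> block \<Rightarrow> block \<Rightarrow> bool" where
  "cover X b c \<longleftrightarrow>
     column_block X b \<and> column_block X c \<and> fst c = fst b + 1 \<and> snd b \<inter> snd c \<noteq> {}"

abbreviation below :: "affine_type \<Rightarrow> block \<Rightarrow> block \<Rightarrow> bool" where
  "below X \<equiv> (cover X)\<^sup>*\<^sup>*"

definition block_of :: "affine_type \<Rightarrow> int \<Rightarrow> nat \<Rightarrow> block" where
  "block_of X k i = (k, {c \<in> cells X. cell_colour (column_pattern X k) c = i})"

lemma fst_block_of [simp]: "fst (block_of X k i) = k"
  by (simp add: block_of_def)

lemma set_word_phase: "set (word X (phase X k)) = cell_colour (column_pattern X k) ` cells X"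
  by (simp add: word_eq colours_def cells_eq column_pattern_phase)

lemma colour_block_iff:
  "colour_block X i b \<longleftrightarrow> b = block_of X (fst b) i \<and> i \<in> set (word X (phase X (fst b)))"
  by (cases b) (auto simp: is_colour_block_def block_of_def set_word_phase)

lemma colour_block_unique: "is_colour_block X P i b \<Longrightarrow> is_colour_block X P j b \<Longrightarrow> i = j"
  unfolding is_colour_block_def by auto

lemma block_cells: "is_block X P b \<Longrightarrow> snd b \<subseteq> cells X"
  by (auto simp: is_block_def is_colour_block_def)

lemma colour_block_is_block: "is_colour_block X P i b \<Longrightarrow> is_block X P b"
  by (auto simp: is_block_def)

lemma cell_in_block:
  assumes "c \<in> cells X"
  shows "is_colour_block X P (cell_colour (P k) c) (k, {c' \<in> cells X. cell_colour (P k) c' =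
    cell_colour (P k) c})"
  using assms unfolding is_colour_block_def fst_conv snd_conv by blast

lemma cover_block_of:
  assumes "(a, b) \<in> set (zip (word X (q + Suc n)) (word X (q + n)))"
    and pat: "\<And>n. column_pattern X (k + int n) = section_at X (q + n)"
  shows "cover X (block_of X (k + int n) b) (block_of X (k + int (Suc n)) a)"
proof -
  have pat': "column_pattern X (k + int n) = section_at X (q + n)"
    "column_pattern X (k + int (Suc n)) = section_at X (q + Suc n)"
    by (rule pat)+
  obtain c where c: "c \<in> cells X"
    "a = cell_colour (column_pattern X (k + int (Suc n))) c"
    "b = cell_colour (column_pattern X (k + int n)) c"
    using assms(1)
    unfolding word_eq colours_def zip_map1 zip_map2 zip_same_conv_map cells_eq pat'[symmetric]
    by auto
  have "colour_block X b (block_of X (k + int n) b)"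
    "colour_block X a (block_of X (k + int (Suc n)) a)"
    "c \<in> snd (block_of X (k + int n) b)" "c \<in> snd (block_of X (k + int (Suc n)) a)"
    using c unfolding is_colour_block_def block_of_def fst_conv snd_conv by blast+
  then show ?thesis
    unfolding cover_def is_block_def by fastforce
qed

lemma set_rise: "set (rise S ps) = {a. \<exists>b\<in>set S. (a, b) \<in> set ps}"
  by (induction S ps rule: rise.induct) auto

lemma ascent_below:
  assumes "\<And>n. column_pattern X (k + int n) = section_at X (q + n)"
  shows "j \<in> set (ascent X q i n) \<Longrightarrow> below X (block_of X k i) (block_of X (k + int n) j)"
proof (induction n arbitrary: j)
  case (Suc n)
  then obtain b where "b \<in> set (ascent X q i n)"
    "(j, b) \<in> set (zip (word X (q + Suc n)) (word X (q + n)))"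
    by (auto simp: set_rise)
  with Suc.IH[of b] cover_block_of[OF this(2) assms] show ?case
    by (meson rtranclp.rtrancl_into_rtrancl)
qed simp

lemma below_height: "below X b c \<Longrightarrow> fst b \<le> fst c"
  by (induction rule: rtranclp_induct) (auto simp: cover_def)

lemma below_height_eq: "below X b c \<Longrightarrow> fst b = fst c \<Longrightarrow> b = c"
proof (induction rule: rtranclp_induct)
  case (step y z)
  then have "fst z = fst y + 1" by (simp add: cover_def)
  then show ?case using below_height[OF step.hyps(1)] step.prems by simp
qed simp

lemma phase_check_at: "phase_check X (phase X k)"
  by (rule phase_check[OF phase_less])

lemma column_pattern_Suc: "column_pattern X (k + 1) = section_at X (Suc (phase X k))"
  using column_pattern_add[of X k 1] by simp

lemma cover_adjacent:
  assumes "cover X b c" "colour_block X i b" "colour_block X j c"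
  shows "adjacent X j i"
proof -
  obtain d where d: "d \<in> snd b" "d \<in> snd c" "fst c = fst b + 1"
    using assms(1) by (auto simp: cover_def)
  have "d \<in> cells X" "cell_colour (column_pattern X (fst b)) d = i"
    "cell_colour (column_pattern X (fst b + 1)) d = j"
    using assms(2,3) d by (auto simp: is_colour_block_def)
  moreover have "list_all2 (adjacent X) (word X (Suc (phase X (fst b)))) (word X (phase X (fst b)))"
    using phase_check_at by (simp add: phase_check_def)
  ultimately show ?thesis
    by (auto simp: word_eq colours_def list_all2_map1 list_all2_map2 list_all2_same cells_eq
        column_pattern_Suc column_pattern_phase[of X "fst b"])
qed

lemma cover_colours_distinct:
  "cover X b c \<Longrightarrow> colour_block X i b \<Longrightarrow> colour_block X j c \<Longrightarrow> i \<noteq> j"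
  using cover_adjacent[of X b c i j] by (cases X) (auto simp: adjacent_def)

lemma exists_covered:
  assumes "column_block X c"
  obtains b where "cover X b c"
proof -
  obtain d where d: "d \<in> snd c" "d \<in> cells X"
    using assms by (auto simp: is_block_def is_colour_block_def)
  show ?thesis
    using d cell_in_block[OF d(2), of "column_pattern X" "fst c - 1"] assms
    by (intro that[of "(fst c - 1, {c' \<in> cells X. cell_colour (column_pattern X (fst c - 1)) c'
           = cell_colour (column_pattern X (fst c - 1)) d})"])
      (auto simp: cover_def is_block_def)
qed

lemma check_comparable:
  assumes "colour_block X i b" "colour_block X j c" "fst c = fst b + int n" "n \<le> span X"
    and "i = j \<or> adjacent X i j \<or> n = span X"
  shows "below X b c"
proof -
  let ?q = "phase X (fst b)"
  have "word X (?q + n) = word X (phase X (fst c))"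
    using column_pattern_add[of X "fst b" n] assms(3)
    by (simp add: word_eq column_pattern_phase)
  then have "j \<in> set (word X (?q + n))" "i \<in> set (word X ?q)"
    using assms(1,2) by (auto simp: colour_block_iff)
  moreover have "n \<in> set [0..<Suc (span X)]"
    using assms(4) by auto
  then have "comparable_level X ?q n"
    using phase_check_at[of X "fst b"] unfolding phase_check_def list_all_iff by blast
  ultimately have "j \<in> set (ascent X ?q i n)"
    using assms(5) by (auto simp: comparable_level_def comparable_above_def comparable_at_def
      list_all_iff)
  from ascent_below[OF column_pattern_add this] show ?thesis
    using assms(1-3) by (simp add: colour_block_iff)
qed

text \<open>Induction on the distance beyond \<open>span X\<close>: descending from \<open>c\<close>
  by one cover keeps the distance large enough, and the base case is the check at exactly
  \<open>span X\<close>, where colours do not matter.\<close>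

lemma below_far:
  assumes "column_block X b" "column_block X c" "fst b + int (span X) \<le> fst c"
  shows "below X b c"
proof -
  have "\<And>c. column_block X c \<Longrightarrow> fst c = fst b + int (span X + n) \<Longrightarrow> below X b c" for n
  proof (induction n)
    case 0
    then show ?case
      using assms(1) check_comparable[where n = "span X" and X = X and b = b and c = c]
      unfolding is_block_def by auto
  next
    case (Suc n)
    then obtain d where d: "cover X d c"
      using exists_covered by blast
    then have "below X b d"
      using Suc by (intro Suc.IH) (auto simp: cover_def)
    with d show ?case by (rule rtranclp.rtrancl_into_rtrancl[rotated])
  qed
  from this[of c "nat (fst c - fst b) - span X"] assms show ?thesis
    by auto
qed

lemma adjacent_sym: "adjacent X i j \<longleftrightarrow> adjacent X j i"
  by (auto simp: adjacent_def)

text \<open>Up to distance \<open>span X\<close> this is the finite check, beyond it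
  \<open>below_far\<close>. With \<open>cover_adjacent\<close> it makes the blocks a heap over the
  Dynkin diagram.\<close>

lemma comparable:
  assumes "colour_block X i b" "colour_block X j c" "i = j \<or> adjacent X i j"
  shows "below X b c \<or> below X c b"
proof -
  have *: "below X b c"
    if "colour_block X i b" "colour_block X j c" "i = j \<or> adjacent X i j" "fst b \<le> fst c"
    for b c i j
  proof (cases "fst c - fst b \<le> int (span X)")
    case True
    then show ?thesis
      using that by (intro check_comparable[where n = "nat (fst c - fst b)"]) auto
  next
    case False
    then show ?thesis
      using that by (intro below_far) (auto simp: is_block_def)
  qed
  show ?thesis
  proof (cases "fst b \<le> fst c")
    case True
    then show ?thesis using * assms by blast
  next
    case False
    then show ?thesis using *[of j c i b] assms adjacent_sym by auto
  qed
qed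

section \<open>Rotation and the motion \<sigma>\<close>

lemma turn_cell_cells: "c \<in> cells X \<Longrightarrow> turn_cell X c \<in> cells X"
  by (cases X; cases "(X, c)" rule: turn_cell.cases) (auto simp: cells_def)

lemma turn_cell_turn_cell: "c \<in> cells X \<Longrightarrow> turn_cell X (turn_cell X c) = c"
  by (cases X; cases "(X, c)" rule: turn_cell.cases) (auto simp: cells_def)

lemma turn_image_eq: "S \<subseteq> cells X \<Longrightarrow> turn_cell X ` S = {d \<in> cells X. turn_cell X d \<in> S}"
  using turn_cell_cells turn_cell_turn_cell by force

lemma turn_image_turn_image: "S \<subseteq> cells X \<Longrightarrow> turn_cell X ` turn_cell X ` S = S"
  using turn_cell_turn_cell by (force simp: image_image subset_iff)

lemma turn_image_subset: "S \<subseteq> cells X \<Longrightarrow> turn_cell X ` S \<subseteq> cells X"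
  using turn_cell_cells by blast

text \<open>The cells are listed row by row from the upper left, so that rotation reverses the list;
  this is why the checks apply \<open>rev\<close> to words.\<close>

lemma rev_cell_list: "rev (cell_list X) = map (turn_cell X) (cell_list X)"
  by (cases X) simp_all

lemma same_partition_lift:
  assumes "c \<in> cells X" "d \<in> cells X"
  shows "cell_colour (column_pattern X k) (turn_cell X c) =
    cell_colour (column_pattern X k) (turn_cell X d) \<longleftrightarrow>
    cell_colour (column_pattern X (k + int (lift X))) c =
      cell_colour (column_pattern X (k + int (lift X))) d"
proof -
  let ?f = "\<lambda>c. cell_colour (column_pattern X k) (turn_cell X c)"
  let ?g = "cell_colour (column_pattern X (k + int (lift X)))"
  have "same_partition (rev (word X (phase X k))) (word X (phase X k + lift X))"
    using phase_check_at[of X k] by (simp add: phase_check_def)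
  moreover have "zip (rev (word X (phase X k))) (word X (phase X k + lift X)) =
    map (\<lambda>c. (?f c, ?g c)) (cell_list X)"
    by (simp add: word_eq colours_def rev_map rev_cell_list zip_map1 zip_map2 zip_same_conv_map
      column_pattern_add
        column_pattern_phase[of X k])
  ultimately have "inj_on fst ((\<lambda>c. (?f c, ?g c)) ` cells X)" "inj_on snd ((\<lambda>c. (?f c, ?g c)) `
    cells X)"
    by (auto simp: same_partition_def distinct_map cells_eq)
  then have "(?f c, ?g c) = (?f d, ?g d)" if "?f c = ?f d \<or> ?g c = ?g d"
    using that assms by (auto dest!: inj_onD[where x = "(?f c, ?g c)" and y = "(?f d, ?g d)"])
  then show ?thesis by blast
qed

lemma is_block_iff:
  "is_block X P (k, S) \<longleftrightarrow>
     (\<exists>c\<in>cells X. S = {d \<in> cells X. cell_colour (P k) d = cell_colour (P k) c})"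
  by (auto simp: is_block_def is_colour_block_def)

abbreviation lift_block :: "affine_type \<Rightarrow> block \<Rightarrow> block" where
  "lift_block X \<equiv> move_block X (int (lift X), True)"

lemma column_block_lift_iff:
  assumes "S \<subseteq> cells X"
  shows "column_block X (k + int (lift X), turn_cell X ` S) \<longleftrightarrow> column_block X (k, S)"
proof -
  let ?f = "cell_colour (column_pattern X k)"
  let ?g = "cell_colour (column_pattern X (k + int (lift X)))"
  have img: "turn_cell X ` {d \<in> cells X. ?f d = ?f (turn_cell X c)} = {d \<in> cells X. ?g d = ?g c}"
    if "c \<in> cells X" for c
    using that same_partition_lift[of _ X c k] turn_cell_cells
    by (subst turn_image_eq) auto
  show ?thesis
  proof
    assume "column_block X (k + int (lift X), turn_cell X ` S)"
    then obtain c where c: "c \<in> cells X" "turn_cell X ` S = {d \<in> cells X. ?g d = ?g c}"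
      by (auto simp: is_block_iff)
    then have "turn_cell X ` turn_cell X ` S = turn_cell X ` turn_cell X ` {d \<in> cells X. ?f d =
      ?f (turn_cell X c)}"
      using img by simp
    then have "S = {d \<in> cells X. ?f d = ?f (turn_cell X c)}"
      by (simp add: turn_image_turn_image assms)
    then show "column_block X (k, S)"
      using c(1) turn_cell_cells unfolding is_block_iff by blast
  next
    assume "column_block X (k, S)"
    then obtain c where c: "c \<in> cells X" "S = {d \<in> cells X. ?f d = ?f c}"
      by (auto simp: is_block_iff)
    then have "turn_cell X ` S = {d \<in> cells X. ?g d = ?g (turn_cell X c)}"
      using img[of "turn_cell X c"] turn_cell_cells turn_cell_turn_cell by simp
    then show "column_block X (k + int (lift X), turn_cell X ` S)"
      using c(1) turn_cell_cells unfolding is_block_iff by blast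
  qed
qed

text \<open>Outside a window of heights one of the two comparisons follows from distance alone;
  inside it, \<open>lift_level\<close> decides from the colours of \<open>b\<close>, of
  \<open>d\<close> and of the image of \<open>d\<close>.\<close>

lemma below_lift:
  assumes b: "column_block X b" and d: "column_block X d"
  shows "below X b (lift_block X d) \<or> below X d b"
proof -
  have d': "column_block X (lift_block X d)"
    using column_block_lift_iff[of "snd d" X "fst d"] block_cells[OF d] d
    by (simp add: move_block_def)
  \<comment> \<open>\<open>lift X\<close> is one less than \<open>span X\<close>, so the window has
    exactly \<open>span X\<close> heights, and \<open>lift X - m\<close> is never truncated.\<close>
  have ls: "lift X \<le> span X" "int (lift X) - int (span X) = - 1" "\<And>m. m < span X \<Longrightarrow> m \<le> lift X"
    by (cases X; simp)+
  consider "fst b \<ge> fst d + int (span X)" | "fst b \<le> fst d + int (lift X) - int (span X)"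
    | "fst d \<le> fst b" "fst b < fst d + int (span X)"
    using ls by linarith
  then show ?thesis
  proof cases
    case 1
    then show ?thesis using below_far[OF d b] by simp
  next
    case 2
    then show ?thesis using below_far[OF b d'] by (simp add: move_block_def)
  next
    case 3
    define m where "m = nat (fst b - fst d)"
    have m: "m < span X" "fst b = fst d + int m" using 3 by (auto simp: m_def)
    let ?q = "phase X (fst d)"
    obtain i where i: "colour_block X i b" using b by (auto simp: is_block_def)
    obtain j' where j': "colour_block X j' d" using d by (auto simp: is_block_def)
    obtain j where j: "colour_block X j (lift_block X d)" using d' by (auto simp: is_block_def)
    obtain e where e: "e \<in> snd d" "e \<in> cells X" using j' by (auto simp: is_colour_block_def)
    have col_e: "cell_colour (column_pattern X (fst d)) e = j'"
      using j' e by (auto simp: is_colour_block_def)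
    have "turn_cell X e \<in> snd (lift_block X d)"
      using e by (auto simp: move_block_def)
    then have col_te: "cell_colour (column_pattern X (fst d + int (lift X))) (turn_cell X e) = j"
      using j by (auto simp: is_colour_block_def move_block_def)
    have pair: "(j', j) \<in> set (zip (rev (word X ?q)) (word X (?q + lift X)))"
    proof -
      have "zip (rev (word X ?q)) (word X (?q + lift X)) =
        map (\<lambda>c. (cell_colour (column_pattern X (fst d)) (turn_cell X c),
          cell_colour (column_pattern X (fst d + int (lift X))) c)) (cell_list X)"
        by (simp add: word_eq colours_def rev_map rev_cell_list zip_map1 zip_map2 zip_same_conv_map
            column_pattern_add column_pattern_phase[of X "fst d"])
      moreover have "turn_cell X e \<in> set (cell_list X)"
        using e turn_cell_cells by (simp flip: cells_eq)
      ultimately show ?thesis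
        using col_e col_te turn_cell_turn_cell[OF e(2)] by force
    qed
    have wi: "i \<in> set (word X (?q + m))"
      using i column_pattern_add[of X "fst d" m] m(2)
      by (simp add: colour_block_iff word_eq column_pattern_phase)
    have "m \<in> set [0..<span X]" using m by simp
    then have "lift_level X ?q m"
      using phase_check_at[of X "fst d"] unfolding phase_check_def list_all_iff by blast
    then have "j \<in> set (ascent X (?q + m) i (lift X - m)) \<or> i \<in> set (ascent X ?q j' m)"
      using wi pair by (force simp: lift_level_def lift_above_def lift_at_def list_all_iff)
    then show ?thesis
    proof
      assume *: "j \<in> set (ascent X (?q + m) i (lift X - m))"
      have "column_pattern X (fst b + int n) = section_at X (?q + m + n)" for n
        using column_pattern_add[of X "fst d" "m + n"] m(2) by (simp add: algebra_simps)
      from ascent_below[OF this *] ls(3)[OF m(1)] m(2) i j show ?thesis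
        by (simp add: colour_block_iff move_block_def algebra_simps of_nat_diff)
    next
      assume "i \<in> set (ascent X ?q j' m)"
      from ascent_below[OF column_pattern_add this] m(2) i j' show ?thesis
        by (simp add: colour_block_iff)
    qed
  qed
qed

declare split_paired_All [simp del] split_paired_Ex [simp del]

section \<open>Columns as order ideals\<close>

abbreviation add_block :: "affine_type \<Rightarrow> nat \<Rightarrow> block set \<Rightarrow> block \<Rightarrow> bool" where
  "add_block X \<equiv> addable X (column_pattern X)"

abbreviation remove_block :: "affine_type \<Rightarrow> nat \<Rightarrow> block set \<Rightarrow> block \<Rightarrow> bool" where
  "remove_block X \<equiv> removable X (column_pattern X)"

lemma column_iff:
  "column X y \<longleftrightarrow> y \<noteq> {} \<and> (\<forall>b\<in>y. column_block X b) \<and> (\<exists>h. \<forall>b\<in>y. fst b \<le> h) \<and>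
     (\<forall>b c. cover X b c \<and> c \<in> y \<longrightarrow> b \<in> y)" (is "_ \<longleftrightarrow> ?A \<and> ?B \<and> ?C \<and> ?D")
proof -
  have "?D \<longleftrightarrow> (\<forall>k S S'. (k, S) \<in> y \<and> column_block X (k - 1, S') \<and> S \<inter> S' \<noteq> {} \<longrightarrow> (k - 1, S') \<in> y)"
      (is "_ \<longleftrightarrow> ?E") if ?B
  proof
    assume D: ?D
    show ?E
    proof (intro allI impI)
      fix k S S' assume *: "(k, S) \<in> y \<and> column_block X (k - 1, S') \<and> S \<inter> S' \<noteq> {}"
      then have "cover X (k - 1, S') (k, S)"
        using that by (auto simp: cover_def)
      with D * show "(k - 1, S') \<in> y" by blast
    qed
  next
    assume E: ?E
    show ?D
    proof (intro allI impI)
      fix b c assume *: "cover X b c \<and> c \<in> y"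
      then have "(fst c, snd c) \<in> y \<and> column_block X (fst c - 1, snd b) \<and> snd c \<inter> snd b \<noteq> {}"
        by (cases b; cases c) (auto simp: cover_def)
      with E have "(fst c - 1, snd b) \<in> y" by blast
      moreover have "(fst c - 1, snd b) = b" using * by (cases b) (simp add: cover_def)
      ultimately show "b \<in> y" by simp
    qed
  qed
  then have "?A \<and> ?B \<and> ?C \<and> ?E \<longleftrightarrow> ?A \<and> ?B \<and> ?C \<and> ?D"
    by (intro conj_cong refl) (rule sym)
  then show ?thesis by (rule trans[OF young_column_def])
qed

lemma column_block_in: "column X y \<Longrightarrow> b \<in> y \<Longrightarrow> column_block X b"
  by (simp add: column_iff)

lemma column_cover: "column X y \<Longrightarrow> cover X b c \<Longrightarrow> c \<in> y \<Longrightarrow> b \<in> y"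
  unfolding column_iff by blast

lemma column_below:
  assumes "below X b c" "column X y" "c \<in> y"
  shows "b \<in> y"
  using assms by (induction rule: converse_rtranclp_induct) (auto intro: column_cover)

lemma below_block: "below X b c \<Longrightarrow> column_block X c \<Longrightarrow> column_block X b"
  by (induction rule: converse_rtranclp_induct) (auto simp: cover_def)

text \<open>Everything at least \<open>span X\<close> cubes under some block of the column lies
  below it in the order.\<close>

lemma column_low:
  assumes "column X y"
  obtains k where "\<And>b. column_block X b \<Longrightarrow> fst b \<le> k \<Longrightarrow> b \<in> y"
proof -
  obtain c where c: "c \<in> y" "column_block X c"
    using assms by (auto simp: column_iff)
  show ?thesis
    using below_far[OF _ c(2)] column_below[OF _ assms c(1)]
    by (intro that[of "fst c - int (span X)"]) simp
qed

lemma column_high: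
  assumes "column X y"
  obtains h where "\<And>b. b \<in> y \<Longrightarrow> fst b \<le> h"
  using assms unfolding column_iff by blast

lemma finite_column_diff:
  assumes "column X y" "column X y'"
  shows "finite (y - y')"
proof -
  obtain h where h: "\<And>b. b \<in> y \<Longrightarrow> fst b \<le> h" using column_high[OF assms(1)] by blast
  obtain k where k: "\<And>b. column_block X b \<Longrightarrow> fst b \<le> k \<Longrightarrow> b \<in> y'"
    using column_low[OF assms(2)] by blast
  have "y - y' \<subseteq> {k..h} \<times> Pow (cells X)"
  proof
    fix b assume b: "b \<in> y - y'"
    then have "column_block X b" using assms column_block_in by auto
    then show "b \<in> {k..h} \<times> Pow (cells X)"
      using b h[of b] k[of b] block_cells[of X _ b] by (cases b) force
  qed
  then show ?thesis
    by (rule finite_subset) (simp add: cells_eq)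
qed

lemma column_down:
  assumes "column_block X b"
  shows "column X {c. below X c b}"
  unfolding column_iff
proof (intro conjI)
  show "{c. below X c b} \<noteq> {}" by blast
  show "\<forall>c\<in>{c. below X c b}. column_block X c"
    using assms below_block by blast
  show "\<exists>h. \<forall>c\<in>{c. below X c b}. fst c \<le> h"
    using below_height by blast
  show "\<forall>a c. cover X a c \<and> c \<in> {c. below X c b} \<longrightarrow> a \<in> {c. below X c b}"
    by (auto intro: converse_rtranclp_into_rtranclp)
qed

lemma column_minus:
  assumes "column X y" "b \<in> y" "\<And>c. c \<in> y \<Longrightarrow> \<not> cover X b c"
  shows "column X (y - {b})"
proof -
  \<comment> \<open>A block under \<open>b\<close> survives the removal, so the smaller column is
    still non-empty.\<close>
  obtain a where "cover X a b"
    using exists_covered[OF column_block_in[OF assms(1,2)]] .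
  then have "a \<in> y - {b}"
    using assms column_cover by (fastforce simp: cover_def)
  then show ?thesis using assms unfolding column_iff by blast
qed

lemma column_insert:
  assumes "column X y" "column_block X b" "\<And>c. cover X c b \<Longrightarrow> c \<in> y"
  shows "column X (insert b y)"
proof -
  obtain h where "\<And>c. c \<in> y \<Longrightarrow> fst c \<le> h" using column_high[OF assms(1)] by blast
  then have "\<forall>c\<in>insert b y. fst c \<le> max h (fst b)" by fastforce
  then show ?thesis using assms unfolding column_iff by blast
qed

lemma remove_iff:
  assumes "column X y"
  shows "remove_block X i y b \<longleftrightarrow> colour_block X i b \<and> b \<in> y \<and> (\<forall>c\<in>y. \<not> cover X b c)"
proof -
  have "\<not> cover X b c" if "column X (y - {b})" "c \<in> y" for c
  proof
    assume c: "cover X b c"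
    then have "c \<noteq> b" by (auto simp: cover_def)
    then show False using column_cover[OF that(1) c] that(2) by blast
  qed
  then show ?thesis
    unfolding removable_def using column_minus[OF assms] by blast
qed

lemma add_iff:
  assumes "column X y"
  shows "add_block X i y b \<longleftrightarrow> colour_block X i b \<and> b \<notin> y \<and> (\<forall>c. cover X c b \<longrightarrow> c \<in> y)"
proof -
  have "c \<in> y" if "column X (insert b y)" "cover X c b" for c
    using that column_cover[OF that(1), of c b] by (auto simp: cover_def)
  then show ?thesis
    unfolding addable_def using column_insert[OF assms] colour_block_is_block by blast
qed

lemma remove_column: "remove_block X i y b \<Longrightarrow> column X (y - {b})"
  by (simp add: removable_def)

lemma add_column: "add_block X i y b \<Longrightarrow> column X (insert b y)"
  by (simp add: addable_def)

text \<open>Two candidates of one colour are comparable; if they differed, the lower one would lie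
  below a support of the upper one, hence already in \<open>y\<close>.\<close>

lemma add_unique:
  assumes y: "column X y" and "add_block X i y b" "add_block X i y c"
  shows "b = c"
proof -
  have *: "b = c" if "below X b c" "add_block X i y b" "add_block X i y c" for b c
    using that(1)
  proof (cases rule: rtranclp.cases)
    case (rtrancl_into_rtrancl d)
    then have "d \<in> y" using that(3) unfolding add_iff[OF y] by blast
    then have "b \<in> y" using rtrancl_into_rtrancl y column_below by blast
    then show ?thesis using that(2) y by (simp add: add_iff)
  qed simp
  show ?thesis
    using comparable[of X i b i c] *[of b c] *[of c b] assms by (auto simp: add_iff)
qed

lemma remove_unique:
  assumes y: "column X y" and "remove_block X i y b" "remove_block X i y c"
  shows "b = c"
proof -
  have *: "b = c" if "below X b c" "remove_block X i y b" "remove_block X i y c" for b c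
    using that(1)
  proof (cases rule: converse_rtranclpE)
    case (step d)
    then have "d \<in> y" using that(3) y column_below by (auto simp: remove_iff)
    then show ?thesis using that(2) y step by (auto simp: remove_iff)
  qed
  show ?thesis
    using comparable[of X i b i c] *[of b c] *[of c b] assms by (auto simp: remove_iff)
qed

text \<open>The addable \<open>b\<close> would lie above the removable \<open>c\<close>. The block
  covering \<open>c\<close> on a chain to \<open>b\<close> is either \<open>b\<close> itself,
  impossible since covers change the colour, or lies below a support of \<open>b\<close>, hence in
  \<open>y\<close>, against the maximality of \<open>c\<close>. So adding or removing an
  \<open>i\<close>-block never opens the way for a second one.\<close>

lemma add_not_remove:
  assumes y: "column X y" and b: "add_block X i y b" and c: "remove_block X i y c"
  shows False
proof -
  have b': "colour_block X i b" "b \<notin> y" "\<And>d. cover X d b \<Longrightarrow> d \<in> y"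
    using b y by (auto simp: add_iff)
  have c': "colour_block X i c" "c \<in> y" "\<And>d. d \<in> y \<Longrightarrow> \<not> cover X c d"
    using c y by (auto simp: remove_iff)
  have "\<not> below X b c" using column_below y b' c' by blast
  then have "below X c b" using comparable[of X i b i c] b' c' by blast
  then show False
  proof (cases rule: converse_rtranclpE)
    case base
    then show ?thesis using b' c' by simp
  next
    case (step d)
    from step(2) show ?thesis
    proof (cases rule: rtranclp.cases)
      case rtrancl_refl
      then show ?thesis using step(1) cover_colours_distinct b' c' by blast
    next
      case (rtrancl_into_rtrancl e)
      then have "d \<in> y" using b' column_below y by blast
      then show ?thesis using c' step by blast
    qed
  qed
qed

lemma remove_imp_add: "column X y \<Longrightarrow> remove_block X i y b \<Longrightarrow> add_block X i (y - {b}) b"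
  by (auto simp: addable_def removable_def insert_absorb)

lemma add_imp_remove: "column X y \<Longrightarrow> add_block X i y b \<Longrightarrow> remove_block X i (insert b y) b"
  by (auto simp: addable_def removable_def)

text \<open>A block of greatest height in the finite difference is maximal in \<open>y\<close>:
  whatever covers it in \<open>y\<close> is again outside the ideal \<open>y'\<close>, and would be
  higher.\<close>

lemma exists_remove_diff:
  assumes "column X y" "column X y'" "y' \<subset> y"
  obtains i x where "remove_block X i y x" "x \<notin> y'"
proof -
  let ?D = "y - y'"
  have D: "finite ?D" "?D \<noteq> {}" using finite_column_diff[OF assms(1,2)] assms(3) by auto
  then have "Max (fst ` ?D) \<in> fst ` ?D" by (intro Max_in) auto
  then obtain x where x: "x \<in> ?D" "fst x = Max (fst ` ?D)" by auto
  have "\<not> cover X x c" if "c \<in> y" for c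
  proof
    assume c: "cover X x c"
    then have "c \<in> ?D" using x that column_cover[OF assms(2)] by blast
    then have "fst c \<le> fst x" using D x by simp
    then show False using c by (simp add: cover_def)
  qed
  moreover obtain i where "colour_block X i x"
    using x column_block_in[OF assms(1), of x] unfolding is_block_def by blast
  ultimately have "remove_block X i y x" using x assms(1) by (auto simp: remove_iff)
  with x show ?thesis by (intro that) auto
qed

section \<open>Motions\<close>

text \<open>\<open>to_column_pattern\<close> with a free target, so that motions can be inverted and
  composed between patterns.\<close>

definition carries :: "pattern \<Rightarrow> pattern \<Rightarrow> motion \<Rightarrow> bool" where
  "carries P Q g \<longleftrightarrow> (\<forall>k. Q (k + fst g) = (if snd g then turn_section (P k) else P k))"

definition well_formed :: "affine_type \<Rightarrow> pattern \<Rightarrow> bool" where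
  "well_formed X P \<longleftrightarrow> (\<forall>k. length (fst (P k)) = width X \<and> length (snd (P k)) = width X)"

definition inverse_motion :: "motion \<Rightarrow> motion" where
  "inverse_motion g = (- fst g, snd g)"

definition compose_motion :: "motion \<Rightarrow> motion \<Rightarrow> motion" where
  "compose_motion g h = (fst g + fst h, snd g \<noteq> snd h)"

lemma to_column_pattern_carries: "to_column_pattern X P g \<longleftrightarrow> carries P (column_pattern X) g"
  by (simp add: to_column_pattern_def carries_def)

lemma turn_section_turn_section [simp]: "turn_section (turn_section s) = s"
  by (simp add: turn_section_def)

lemma carries_inverse: "carries P Q g \<Longrightarrow> carries Q P (inverse_motion g)"
  unfolding carries_def inverse_motion_def
proof
  fix k assume *: "\<forall>k. Q (k + fst g) = (if snd g then turn_section (P k) else P k)"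
  from *[rule_format, of "k - fst g"]
  show "P (k + fst (- fst g, snd g)) = (if snd (- fst g, snd g) then turn_section (Q k) else Q k)"
    by simp
qed

lemma carries_compose: "carries P Q g \<Longrightarrow> carries Q R h \<Longrightarrow> carries P R (compose_motion h g)"
  unfolding carries_def compose_motion_def
proof
  fix k assume g: "\<forall>k. Q (k + fst g) = (if snd g then turn_section (P k) else P k)"
    and h: "\<forall>k. R (k + fst h) = (if snd h then turn_section (Q k) else Q k)"
  have "k + fst (fst h + fst g, snd h \<noteq> snd g) = (k + fst g) + fst h" by simp
  then show "R (k + fst (fst h + fst g, snd h \<noteq> snd g)) =
    (if snd (fst h + fst g, snd h \<noteq> snd g) then turn_section (P k) else P k)"
    using h[rule_format, of "k + fst g"] g[rule_format, of k] by (auto simp: algebra_simps)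
qed

lemma move_cells: "snd b \<subseteq> cells X \<Longrightarrow> snd (move_block X g b) \<subseteq> cells X"
  using turn_image_subset by (simp add: move_block_def)

lemma move_compose:
  "snd b \<subseteq> cells X \<Longrightarrow> move_block X g (move_block X h b) = move_block X (compose_motion g h) b"
  by (auto simp: move_block_def compose_motion_def turn_image_turn_image)

lemma move_inverse:
  "snd b \<subseteq> cells X \<Longrightarrow> move_block X (inverse_motion g) (move_block X g b) = b"
  "snd b \<subseteq> cells X \<Longrightarrow> move_block X g (move_block X (inverse_motion g) b) = b"
  by (simp_all add: move_block_def inverse_motion_def turn_image_turn_image)

lemma cell_colour_turn:
  "length (fst s) = width X \<Longrightarrow> length (snd s) = width X \<Longrightarrow> c \<in> cells X \<Longrightarrow>
     cell_colour (turn_section s) (turn_cell X c) = cell_colour s c"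
  by (cases "(X, c)" rule: turn_cell.cases)
    (auto simp: cells_def turn_section_def rev_nth)

lemma carries_colour_block:
  assumes g: "carries P Q g" and P: "well_formed X P" and b: "snd b \<subseteq> cells X"
  shows "is_colour_block X Q i (move_block X g b) \<longleftrightarrow> is_colour_block X P i b"
proof (cases "snd g")
  case False
  then show ?thesis using g by (simp add: is_colour_block_def move_block_def carries_def)
next
  case True
  let ?T = "{c \<in> cells X. cell_colour (P (fst b)) c = i}"
  have Q: "Q (fst b + fst g) = turn_section (P (fst b))"
    using g True by (simp add: carries_def)
  have "cell_colour (turn_section (P (fst b))) d = cell_colour (P (fst b)) (turn_cell X d)"
    if "d \<in> cells X" for d
    using cell_colour_turn[of "P (fst b)" X "turn_cell X d"] P that
    by (simp add: well_formed_def turn_cell_cells turn_cell_turn_cell)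
  then have T: "{d \<in> cells X. cell_colour (Q (fst b + fst g)) d = i} = turn_cell X ` ?T"
    unfolding Q by (subst turn_image_eq) (auto simp: turn_cell_cells)
  have "turn_cell X ` snd b = turn_cell X ` ?T \<longleftrightarrow> snd b = ?T"
  proof
    assume "turn_cell X ` snd b = turn_cell X ` ?T"
    then have "turn_cell X ` turn_cell X ` snd b = turn_cell X ` turn_cell X ` ?T" by simp
    then show "snd b = ?T" using turn_image_turn_image[OF b] turn_image_turn_image[of ?T X] by auto
  qed simp
  then show ?thesis
    using True T by (simp add: is_colour_block_def move_block_def)
qed

lemma carries_block:
  "carries P Q g \<Longrightarrow> well_formed X P \<Longrightarrow> snd b \<subseteq> cells X \<Longrightarrow>
     is_block X Q (move_block X g b) \<longleftrightarrow> is_block X P b"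
  by (simp add: is_block_def carries_colour_block)

lemma well_formed_carries: "carries P Q g \<Longrightarrow> well_formed X P \<Longrightarrow> well_formed X Q"
  unfolding well_formed_def
proof
  fix k assume g: "carries P Q g" and P: "\<forall>k. length (fst (P k)) = width X \<and> length (snd (P k)) =
    width X"
  have "Q (k - fst g + fst g) = (if snd g then turn_section (P (k - fst g)) else P (k - fst g))"
    using g unfolding carries_def by blast
  then show "length (fst (Q k)) = width X \<and> length (snd (Q k)) = width X"
    using P by (simp add: turn_section_def)
qed

lemma move_disjoint_iff:
  assumes "snd b \<subseteq> cells X" "snd c \<subseteq> cells X"
  shows "snd (move_block X g b) \<inter> snd (move_block X g c) = {} \<longleftrightarrow> snd b \<inter> snd c = {}"
proof -
  have "inj_on (turn_cell X) (cells X)"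
    using turn_cell_turn_cell by (rule inj_on_inverseI)
  then have "turn_cell X ` snd b \<inter> turn_cell X ` snd c = turn_cell X ` (snd b \<inter> snd c)"
    using assms inj_on_image_Int by metis
  then show ?thesis by (auto simp: move_block_def)
qed

lemma young_column_cells: "young_column X P y \<Longrightarrow> b \<in> y \<Longrightarrow> snd b \<subseteq> cells X"
  using block_cells unfolding young_column_def by blast

lemma carries_young_column:
  assumes g: "carries P Q g" and P: "well_formed X P" and y: "young_column X P y"
  shows "young_column X Q (move_block X g ` y)"
proof -
  have blocks: "\<And>b. b \<in> y \<Longrightarrow> is_block X P b" using y by (simp add: young_column_def)
  obtain h where "\<And>b. b \<in> y \<Longrightarrow> fst b \<le> h" using y unfolding young_column_def by blast
  then have "\<forall>b\<in>move_block X g ` y. fst b \<le> h + fst g" by (auto simp: move_block_def)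
  moreover have "(k - 1, S') \<in> move_block X g ` y"
    if *: "(k, S) \<in> move_block X g ` y" "is_block X Q (k - 1, S')" "S \<inter> S' \<noteq> {}" for k S S'
  proof -
    obtain b where b: "b \<in> y" "(k, S) = move_block X g b" using *(1) by blast
    let ?b' = "move_block X (inverse_motion g) (k - 1, S')"
    have S': "S' \<subseteq> cells X" using block_cells[OF *(2)] by simp
    have b': "move_block X g ?b' = (k - 1, S')" "snd ?b' \<subseteq> cells X"
      using S' move_inverse(2)[of "(k - 1, S')" X g] move_cells[of "(k - 1, S')" X] by auto
    have "is_block X P ?b'"
      using *(2) b' carries_block[OF g P b'(2)] by simp
    moreover have "snd b \<inter> snd ?b' \<noteq> {}"
      using move_disjoint_iff[OF block_cells[OF blocks[OF b(1)]] b'(2), of g] b' b(2) *(3)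
      by (metis snd_conv)
    moreover have "fst ?b' = fst b - 1"
      using b(2) by (auto simp: move_block_def inverse_motion_def)
    ultimately have "(fst b - 1, snd ?b') \<in> y"
      using y b(1) unfolding young_column_def by (metis prod.collapse)
    then have "?b' \<in> y" using \<open>fst ?b' = fst b - 1\<close> by (metis prod.collapse)
    then show ?thesis using b'(1) by (metis imageI)
  qed
  moreover have "\<forall>b\<in>move_block X g ` y. is_block X Q b"
    using blocks carries_block[OF g P] block_cells by blast
  moreover have "y \<noteq> {}" using y by (simp add: young_column_def)
  ultimately show ?thesis unfolding young_column_def by blast
qed

lemma move_image_inverse:
  "(\<And>b. b \<in> y \<Longrightarrow> snd b \<subseteq> cells X) \<Longrightarrow> move_block X (inverse_motion g) ` move_block X g ` y = y"
  by (simp add: image_image move_inverse cong: image_cong)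

lemma move_image_inverse':
  "(\<And>b. b \<in> y \<Longrightarrow> snd b \<subseteq> cells X) \<Longrightarrow> move_block X g ` move_block X (inverse_motion g) ` y = y"
  by (simp add: image_image move_inverse cong: image_cong)

lemma carries_young_column_iff:
  assumes g: "carries P Q g" and P: "well_formed X P" and y: "\<And>b. b \<in> y \<Longrightarrow> snd b \<subseteq> cells X"
  shows "young_column X Q (move_block X g ` y) \<longleftrightarrow> young_column X P y"
  using carries_young_column[OF g P] move_image_inverse[OF y]
    carries_young_column[OF carries_inverse[OF g] well_formed_carries[OF g P]] by metis

lemma move_inj_on: "inj_on (move_block X g) {b. snd b \<subseteq> cells X}"
  by (rule inj_on_inverseI[of _ "move_block X (inverse_motion g)"]) (simp add: move_inverse)

lemma carries_addable:
  assumes g: "carries P Q g" and P: "well_formed X P" and y: "young_column X P y"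
    and b: "snd b \<subseteq> cells X"
  shows "addable X Q i (move_block X g ` y) (move_block X g b) \<longleftrightarrow> addable X P i y b"
proof -
  have sub: "y \<subseteq> {b. snd b \<subseteq> cells X}" using young_column_cells[OF y] by blast
  have "move_block X g b \<in> move_block X g ` y \<longleftrightarrow> b \<in> y"
    using inj_on_image_mem_iff[OF move_inj_on _ sub] b by simp
  moreover have "young_column X Q (insert (move_block X g b) (move_block X g ` y)) \<longleftrightarrow>
      young_column X P (insert b y)"
    using carries_young_column_iff[OF g P, of "insert b y"] b young_column_cells[OF y] by auto
  ultimately show ?thesis
    using carries_colour_block[OF g P b] by (simp add: addable_def)
qed

lemma carries_removable:
  assumes g: "carries P Q g" and P: "well_formed X P" and y: "young_column X P y"
    and b: "snd b \<subseteq> cells X"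
  shows "removable X Q i (move_block X g ` y) (move_block X g b) \<longleftrightarrow> removable X P i y b"
proof -
  have sub: "y \<subseteq> {b. snd b \<subseteq> cells X}" using young_column_cells[OF y] by blast
  have mem: "move_block X g b \<in> move_block X g ` y \<longleftrightarrow> b \<in> y"
    using inj_on_image_mem_iff[OF move_inj_on _ sub] b by simp
  have "move_block X g ` y - {move_block X g b} = move_block X g ` (y - {b})"
    using sub b by (subst inj_on_image_set_diff[OF move_inj_on]) auto
  then have "young_column X Q (move_block X g ` y - {move_block X g b}) \<longleftrightarrow>
      young_column X P (y - {b})"
    using carries_young_column_iff[OF g P, of "y - {b}"] young_column_cells[OF y] by auto
  then show ?thesis
    using carries_colour_block[OF g P b] mem by (simp add: removable_def)
qed

section \<open>Powers of \<tau>, and the motions from wall columns to the Young column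
  pattern\<close>

fun period_motion :: "affine_type \<Rightarrow> int \<Rightarrow> motion" where
  "period_motion E6 n = (6 * n, odd n)"
| "period_motion E7 n = (8 * n, False)"

fun wall_motion :: "affine_type \<Rightarrow> nat \<Rightarrow> motion" where
  "wall_motion E6 r = (8 * int r, False)"
| "wall_motion E7 r = (4 * int r, odd r)"

lemma compose_period_motion:
  "compose_motion (period_motion X m) (period_motion X n) = period_motion X (m + n)"
  by (cases X) (auto simp: compose_motion_def)

lemma column_pattern_mod:
  "k mod int (period X) = l mod int (period X) \<Longrightarrow> column_pattern X k = column_pattern X l"
  using mod_diff_cong[of k "int (period X)" l 1 1]
  by (simp add: column_pattern_phase phase_def del: column_pattern.simps)

lemma column_pattern_half_period: "column_pattern E6 (k + 6) = turn_section (column_pattern E6 k)"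
proof -
  have "(k + 6 - 1) mod 12 = (if (k - 1) mod 12 < 6 then (k - 1) mod 12 + 6 else (k - 1) mod 12
    - 6)"
  proof -
    have "(k + 6 - 1) mod 12 = ((k - 1) mod 12 + 6) mod 12"
      by (simp add: mod_add_left_eq)
    also have "\<dots> = (if (k - 1) mod 12 < 6 then (k - 1) mod 12 + 6 else (k - 1) mod 12 - 6)"
    proof (cases "(k - 1) mod 12 < 6")
      case False
      have "((k - 1) mod 12 + 6) mod 12 = ((k - 1) mod 12 - 6) mod 12"
        using mod_add_self2[of "(k - 1) mod 12 - 6" 12] by (simp add: add.commute)
      moreover have "(k - 1) mod 12 < 12" by simp
      ultimately show ?thesis using False by (simp del: pos_mod_bound)
    qed simp
    finally show ?thesis .
  qed
  moreover have "0 \<le> (k - 1) mod 12" by simp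
  ultimately show ?thesis
    by (auto simp: Let_def nat_less_iff nat_diff_distrib nat_add_distrib simp del:
      listed_cubes.simps)
qed

lemma carries_period: "carries (column_pattern X) (column_pattern X) (period_motion X n)"
proof (cases X)
  case E6
  show ?thesis
  proof (cases "even n")
    case True
    then obtain m where "n = 2 * m" by blast
    then show ?thesis
      using column_pattern_mod[of "k + 12 * m" E6 k for k] E6
      by (simp add: carries_def del: column_pattern.simps)
  next
    case False
    then obtain m where "n = 2 * m + 1" by (blast elim: oddE)
    moreover have "column_pattern E6 (k + 6 + 12 * m) = column_pattern E6 (k + 6)" for k
      by (rule column_pattern_mod) simp
    ultimately show ?thesis
      using E6 by (simp add: carries_def column_pattern_half_period algebra_simps del:
        column_pattern.simps)
  qed
next
  case E7
  then show ?thesis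
    using column_pattern_mod[of "k + 8 * n" E7 k for k]
    by (simp add: carries_def del: column_pattern.simps)
qed

text \<open>The image of cube 1 determines the motion: within a period its cross-section occurs only
  once, and its rotation occurs only half a period later (\<open>E6\<close>) or not at all
  (\<open>E7\<close>).\<close>

lemma carries_period_only:
  assumes "carries (column_pattern X) (column_pattern X) g"
  obtains n where "g = period_motion X n"
proof (cases X)
  case E6
  have q: "phase E6 (1 + fst g) < 12" "int (phase E6 (1 + fst g)) = fst g mod 12"
    using phase_less[of E6] by (simp_all add: phase_def)
  have one: "column_pattern E6 1 = ([4, 4], [0, 4])" by simp
  have "sections E6 ! phase E6 (1 + fst g) = (if snd g then ([4, 0], [4, 4]) else ([4, 4], [0, 4]))"
    using assms[unfolded carries_def, rule_format, of 1] q(1)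
    by (simp add: E6 one column_pattern_phase[of _ "1 + fst g"] section_at_def turn_section_def
        del: column_pattern.simps sections.simps)
  moreover have "p = (if s then 6 else 0)"
    if "p < 12" "sections E6 ! p = (if s then ([4, 0], [4, 4]) else ([4, 4], [0, 4]))" for p s
  proof -
    have "\<forall>p\<in>set [0..<12]. sections E6 ! p = (if s then ([4, 0], [4, 4]) else ([4, 4], [0, 4])) \<longrightarrow>
        p = (if s then 6 else 0)"
      by (cases s) (simp_all add: turn_section_def upt_conv_Cons del: set_upt)
    from bspec[OF this, of p] that show ?thesis
      unfolding set_upt by (simp del: sections.simps)
  qed
  ultimately have "phase E6 (1 + fst g) = (if snd g then 6 else 0)"
    using q(1) by blast
  then have "fst g mod 12 = (if snd g then 6 else 0)"
    using q(2) by (auto split: if_splits)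
  then have "fst g = 6 * (fst g div 6)" "odd (fst g div 6) = snd g"
    by (cases "snd g"; presburger)+
  then show ?thesis
    using that[of "fst g div 6"] E6 by (cases g) auto
next
  case E7
  have q: "phase E7 (1 + fst g) < 8" "int (phase E7 (1 + fst g)) = fst g mod 8"
    using phase_less[of E7] by (simp_all add: phase_def)
  have one: "column_pattern E7 1 = ([3, 3, 2], [0, 3, 2])" by simp
  have "sections E7 ! phase E7 (1 + fst g) =
      (if snd g then ([2, 3, 0], [2, 3, 3]) else ([3, 3, 2], [0, 3, 2]))"
    using assms[unfolded carries_def, rule_format, of 1] q(1)
    by (simp add: E7 one column_pattern_phase[of _ "1 + fst g"] section_at_def turn_section_def
        del: column_pattern.simps sections.simps)
  moreover have "p = 0 \<and> \<not> s"
    if "p < 8" "sections E7 ! p = (if s then ([2, 3, 0], [2, 3, 3]) else ([3, 3, 2], [0, 3,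
      2]))" for p s
  proof -
    have "\<forall>p\<in>set [0..<8]. sections E7 ! p = (if s then ([2, 3, 0], [2, 3, 3]) else ([3, 3, 2],
      [0, 3, 2])) \<longrightarrow>
        p = 0 \<and> \<not> s"
      by (cases s) (simp_all add: upt_conv_Cons del: set_upt)
    from bspec[OF this, of p] that show ?thesis
      unfolding set_upt by (simp del: sections.simps)
  qed
  ultimately have "phase E7 (1 + fst g) = 0" "\<not> snd g"
    using q(1) by blast+
  then have "fst g = 8 * (fst g div 8)" "\<not> snd g"
    using q(2) by auto
  then show ?thesis
    using that[of "fst g div 8"] E7 by (cases g) auto
qed

lemma carries_wall: "carries (wall_pattern X r) (column_pattern X) (wall_motion X r)"
proof (cases X)
  case E6
  then show ?thesis by (simp add: carries_def del: column_pattern.simps)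
next
  case E7
  show ?thesis
  proof (cases "even r")
    case True
    then obtain m where "r = 2 * m" by blast
    then show ?thesis
      using column_pattern_mod[of "k + 8 * int m" E7 k for k] E7
      by (simp add: carries_def del: column_pattern.simps)
  next
    case False
    then obtain m where "r = 2 * m + 1" by (blast elim: oddE)
    moreover have "column_pattern E7 (k + 4 + 8 * int m) = column_pattern E7 (k + 4)" for k
      by (rule column_pattern_mod) simp
    ultimately show ?thesis
      using E7 by (simp add: carries_def algebra_simps del: column_pattern.simps)
  qed
qed

lemma well_formed_column: "well_formed X (column_pattern X)"
proof -
  have "phase X k < length (sections X)" for k
    using phase_less[of X k] by (cases X) auto
  moreover have "length (fst s) = width X \<and> length (snd s) =
    width X" if "s \<in> set (sections X)" for s
    using that by (cases X) (auto simp: turn_section_def)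
  moreover have "column_pattern X k = sections X ! phase X k" for k
    using phase_less[of X k] by (simp add: column_pattern_phase section_at_def)
  ultimately show ?thesis
    by (simp add: well_formed_def del: column_pattern.simps)
qed

lemma well_formed_wall: "well_formed X (wall_pattern X r)"
  by (rule well_formed_carries[OF carries_inverse[OF carries_wall] well_formed_column])

section \<open>Translating columns by powers of \<tau>\<close>

definition shift :: "affine_type \<Rightarrow> int \<Rightarrow> block set \<Rightarrow> block set" where
  "shift X n y = move_block X (period_motion X n) ` y"

abbreviation shift_block :: "affine_type \<Rightarrow> int \<Rightarrow> block \<Rightarrow> block" where
  "shift_block X n \<equiv> move_block X (period_motion X n)"

lemma column_cells: "column X y \<Longrightarrow> b \<in> y \<Longrightarrow> snd b \<subseteq> cells X"
  by (rule young_column_cells)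

lemma shift_block_shift_block:
  "snd b \<subseteq> cells X \<Longrightarrow> shift_block X m (shift_block X n b) = shift_block X (m + n) b"
  by (simp add: move_compose compose_period_motion)

lemma shift_block_0 [simp]: "shift_block X 0 b = b"
  by (cases X) (simp_all add: move_block_def)

lemma shift_0 [simp]: "shift X 0 y = y"
  by (simp add: shift_def)

lemma column_shift: "column X y \<Longrightarrow> column X (shift X n y)"
  unfolding shift_def by (rule carries_young_column[OF carries_period well_formed_column])

lemma shift_shift: "column X y \<Longrightarrow> shift X m (shift X n y) = shift X (m + n) y"
  by (simp add: shift_def image_image shift_block_shift_block column_cells cong: image_cong)

lemma shift_mono: "y \<subseteq> y' \<Longrightarrow> shift X n y \<subseteq> shift X n y'"
  by (auto simp: shift_def)

lemma shift_subset_shift: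
  assumes "column X y" "column X y'"
  shows "shift X n y \<subseteq> shift X n y' \<longleftrightarrow> y \<subseteq> y'"
  using shift_mono[of y y' X n] shift_mono[of "shift X n y" "shift X n y'" X "- n"] assms
  by (auto simp: shift_shift)

lemma in_shift_iff:
  assumes "column X y" "snd b \<subseteq> cells X"
  shows "b \<in> shift X n y \<longleftrightarrow> shift_block X (- n) b \<in> y"
proof
  assume "b \<in> shift X n y"
  then obtain c where "c \<in> y" "b = shift_block X n c" by (auto simp: shift_def)
  then show "shift_block X (- n) b \<in> y"
    using column_cells[OF assms(1)] by (simp add: shift_block_shift_block)
next
  assume "shift_block X (- n) b \<in> y"
  then have "shift_block X n (shift_block X (- n) b) \<in> shift X n y"
    by (simp add: shift_def)
  then show "b \<in> shift X n y"
    using assms by (simp add: shift_block_shift_block)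
qed

lemma shift_colour_block:
  "snd b \<subseteq> cells X \<Longrightarrow> colour_block X i (shift_block X n b) \<longleftrightarrow> colour_block X i b"
  by (rule carries_colour_block[OF carries_period well_formed_column])

lemma add_shift:
  "column X y \<Longrightarrow> snd b \<subseteq> cells X \<Longrightarrow> add_block X i (shift X n y) (shift_block X n b) \<longleftrightarrow>
    add_block X i y b"
  unfolding shift_def by (rule carries_addable[OF carries_period well_formed_column])

lemma fst_period_motion: "0 \<le> n \<Longrightarrow> 0 \<le> fst (period_motion X n)"
  by (cases X) auto

text \<open>\<tau> preserves colours, so a block and its translate are comparable, and their heights
  decide the direction.\<close>

lemma below_shift_block:
  assumes "column_block X b" "0 \<le> n"
  shows "below X b (shift_block X n b)"
proof -
  obtain i where i: "colour_block X i b" using assms by (auto simp: is_block_def)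
  then have i': "colour_block X i (shift_block X n b)"
    using shift_colour_block block_cells[OF assms(1)] by blast
  have le: "fst b \<le> fst (shift_block X n b)"
    using fst_period_motion[OF assms(2)] by (simp add: move_block_def)
  from comparable[OF i i'] consider "below X b (shift_block X n b)" | "below X (shift_block X n
    b) b"
    by blast
  then show ?thesis
  proof cases
    case 2
    then have "shift_block X n b = b"
      using le below_height below_height_eq by (metis antisym)
    then show ?thesis by simp
  qed
qed

lemma subset_shift:
  assumes "column X y" "0 \<le> n"
  shows "y \<subseteq> shift X n y"
proof
  fix b assume b: "b \<in> y"
  have c: "snd b \<subseteq> cells X" using column_cells assms b by blast
  have "column_block X (shift_block X (- n) b)"
    using column_block_in[OF assms(1) b] c carries_block[OF carries_period well_formed_column]
      by blast
  from below_shift_block[OF this assms(2)] have "below X (shift_block X (- n) b) b"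
    using c by (simp add: shift_block_shift_block)
  then have "shift_block X (- n) b \<in> y" using column_below assms b by blast
  then show "b \<in> shift X n y" using in_shift_iff assms c by blast
qed

lemma shift_le: "column X y \<Longrightarrow> m \<le> n \<Longrightarrow> shift X m y \<subseteq> shift X n y"
  using subset_shift[OF column_shift, of X y "n - m" m] by (simp add: shift_shift)

section \<open>Crystal operators on classes\<close>

abbreviation column_class :: "affine_type \<Rightarrow> block set \<Rightarrow> yclass" where
  "column_class X \<equiv> class_of X (column_pattern X)"

lemma column_class_eq: "column_class X y = {shift X n y | n. True}"
  unfolding class_of_def to_column_pattern_carries shift_def
  using carries_period carries_period_only by blast

lemma column_class_shift:
  assumes "column X y" shows "column_class X (shift X n y) = column_class X y"
proof -
  have "\<exists>m. shift X k y = shift X m (shift X n y)" for k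
    using shift_shift[OF assms, of "k - n" n] by (metis diff_add_cancel)
  then show ?thesis
    using shift_shift[OF assms] by (auto simp: column_class_eq)
qed

lemma column_class_eq_iff:
  assumes "column X y"
  shows "column_class X y = column_class X y' \<longleftrightarrow> (\<exists>n. y' = shift X n y)"
proof
  assume "column_class X y = column_class X y'"
  moreover have "y' \<in> column_class X y'"
    unfolding column_class_eq using shift_0 by (metis (mono_tags) mem_Collect_eq)
  ultimately have "y' \<in> column_class X y" by simp
  then show "\<exists>n. y' = shift X n y" unfolding column_class_eq by blast
qed (use column_class_shift assms in blast)

lemma crystalE:
  assumes "c \<in> crystal X" obtains y where "column X y" "c = column_class X y"
  using assms by (auto simp: crystal_def)

lemma column_class_crystal: "column X y \<Longrightarrow> column_class X y \<in> crystal X"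
  by (auto simp: crystal_def)

text \<open>The operators on classes act on an arbitrarily chosen representative. Knowing it up to a
  power of \<tau> suffices, because adding and removing blocks commutes with \<tau>.\<close>

lemma some_in_column_class: obtains n where "(SOME z. z \<in> column_class X y) = shift X n y"
proof -
  have "(SOME z. z \<in> column_class X y) \<in> column_class X y"
    by (rule someI[of _ "shift X 0 y"]) (auto simp: column_class_eq intro: exI[of _ 0])
  then show ?thesis using that by (auto simp: column_class_eq)
qed

lemma f_col_Some:
  assumes "addable X P i y b" "\<And>c. addable X P i y c \<Longrightarrow> c = b"
  shows "f_col X P i y = Some (insert b y)"
proof -
  have "(SOME b. addable X P i y b) = b" using assms by (rule some_equality)
  with assms(1) show ?thesis unfolding f_col_def by auto
qed

lemma f_col_None: "(\<And>b. \<not> addable X P i y b) \<Longrightarrow> f_col X P i y = None"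
  by (simp add: f_col_def)

lemma e_col_Some:
  assumes "removable X P i y b" "\<And>c. removable X P i y c \<Longrightarrow> c = b"
  shows "e_col X P i y = Some (y - {b})"
proof -
  have "(SOME b. removable X P i y b) = b" using assms by (rule some_equality)
  with assms(1) show ?thesis unfolding e_col_def by auto
qed

lemma e_col_None: "(\<And>b. \<not> removable X P i y b) \<Longrightarrow> e_col X P i y = None"
  by (simp add: e_col_def)

lemma f_col_carries:
  assumes g: "carries P (column_pattern X) g" and P: "well_formed X P" and y: "young_column X P y"
  shows "f_col X (column_pattern X) i (move_block X g ` y) =
    map_option ((`) (move_block X g)) (f_col X P i y)"
proof (cases "\<exists>b. addable X P i y b")
  case True
  then obtain b where b: "addable X P i y b" by blast
  have col: "column X (move_block X g ` y)" by (rule carries_young_column[OF g P y])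
  have cells: "snd c \<subseteq> cells X" if "addable X P i y c" for c
    using that block_cells colour_block_is_block unfolding addable_def by blast
  have 1: "add_block X i (move_block X g ` y) (move_block X g c)" if "addable X P i y c" for c
    using that cells carries_addable[OF g P y] by blast
  have "c = b" if "addable X P i y c" for c
    using add_unique[OF col 1[OF that] 1[OF b]] inj_onD[OF move_inj_on] cells[OF b] cells[OF
      that] by blast
  then have "f_col X P i y = Some (insert b y)" by (rule f_col_Some[OF b])
  moreover have "f_col X (column_pattern X) i (move_block X g ` y) =
      Some (insert (move_block X g b) (move_block X g ` y))"
    using add_unique[OF col _ 1[OF b]] by (rule f_col_Some[OF 1[OF b]])
  ultimately show ?thesis by simp
next
  case False
  have "\<not> add_block X i (move_block X g ` y) c" for c
  proof
    assume c: "add_block X i (move_block X g ` y) c"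
    then have cc: "snd c \<subseteq> cells X"
      using block_cells colour_block_is_block unfolding addable_def by blast
    then have "addable X P i y (move_block X (inverse_motion g) c)"
      using carries_addable[OF g P y, of "move_block X (inverse_motion g) c" i] c
      by (simp add: move_inverse move_cells)
    with False show False by blast
  qed
  then show ?thesis using False by (simp add: f_col_None)
qed

lemma e_col_carries:
  assumes g: "carries P (column_pattern X) g" and P: "well_formed X P" and y: "young_column X P y"
  shows "e_col X (column_pattern X) i (move_block X g ` y) =
    map_option ((`) (move_block X g)) (e_col X P i y)"
proof (cases "\<exists>b. removable X P i y b")
  case True
  then obtain b where b: "removable X P i y b" by blast
  have col: "column X (move_block X g ` y)" by (rule carries_young_column[OF g P y])
  have cells: "snd c \<subseteq> cells X" if "removable X P i y c" for c
    using that block_cells colour_block_is_block unfolding removable_def by blast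
  have 1: "remove_block X i (move_block X g ` y) (move_block X g c)" if "removable X P i y c" for c
    using that cells carries_removable[OF g P y] by blast
  have "c = b" if "removable X P i y c" for c
    using remove_unique[OF col 1[OF that] 1[OF b]] inj_onD[OF move_inj_on] cells[OF b] cells[OF
      that] by blast
  then have "e_col X P i y = Some (y - {b})" by (rule e_col_Some[OF b])
  moreover have "e_col X (column_pattern X) i (move_block X g ` y) =
      Some (move_block X g ` y - {move_block X g b})"
    using remove_unique[OF col _ 1[OF b]] by (rule e_col_Some[OF 1[OF b]])
  moreover have "move_block X g ` (y - {b}) = move_block X g ` y - {move_block X g b}"
    using cells[OF b] b young_column_cells[OF y] unfolding removable_def
    by (subst inj_on_image_set_diff[OF move_inj_on]) auto
  ultimately show ?thesis by simp
next
  case False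
  have "\<not> remove_block X i (move_block X g ` y) c" for c
  proof
    assume c: "remove_block X i (move_block X g ` y) c"
    then have cc: "snd c \<subseteq> cells X"
      using block_cells colour_block_is_block unfolding removable_def by blast
    then have "removable X P i y (move_block X (inverse_motion g) c)"
      using carries_removable[OF g P y, of "move_block X (inverse_motion g) c" i] c
      by (simp add: move_inverse move_cells)
    with False show False by blast
  qed
  then show ?thesis using False by (simp add: e_col_None)
qed

lemma f_col_column:
  assumes "column X y"
  shows "add_block X i y b \<Longrightarrow> f_col X (column_pattern X) i y = Some (insert b y)"
    and "f_col X (column_pattern X) i y = Some z \<Longrightarrow> \<exists>b. add_block X i y b \<and> z = insert b y"
proof -
  show *: "add_block X i y b \<Longrightarrow> f_col X (column_pattern X) i y = Some (insert b y)" for b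
    using add_unique[OF assms] by (metis f_col_Some)
  show "f_col X (column_pattern X) i y = Some z \<Longrightarrow> \<exists>b. add_block X i y b \<and> z = insert b y"
    using * f_col_None by (metis option.distinct(1) option.inject)
qed

lemma e_col_column:
  assumes "column X y"
  shows "remove_block X i y b \<Longrightarrow> e_col X (column_pattern X) i y = Some (y - {b})"
    and "e_col X (column_pattern X) i y = Some z \<Longrightarrow> \<exists>b. remove_block X i y b \<and> z = y - {b}"
proof -
  show *: "remove_block X i y b \<Longrightarrow> e_col X (column_pattern X) i y = Some (y - {b})" for b
    using remove_unique[OF assms] by (metis e_col_Some)
  show "e_col X (column_pattern X) i y = Some z \<Longrightarrow> \<exists>b. remove_block X i y b \<and> z = y - {b}"
    using * e_col_None by (metis option.distinct(1) option.inject)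
qed

lemma f_cls_column_class:
  assumes y: "column X y"
  shows "f_cls X i (column_class X y) = map_option (column_class X) (f_col X (column_pattern X)
    i y)"
proof -
  obtain n where n: "(SOME z. z \<in> column_class X y) = shift X n y" by (rule some_in_column_class)
  have "column_class X (shift X n z) = column_class X z" if "f_col X (column_pattern X) i y =
    Some z" for z
    using f_col_column(2)[OF y that] add_column column_class_shift by blast
  then show ?thesis
    using f_col_carries[OF carries_period well_formed_column y, of i n]
    unfolding f_cls_def n
    by (cases "f_col X (column_pattern X) i y") (simp_all add: shift_def)
qed

lemma e_cls_column_class:
  assumes y: "column X y"
  shows "e_cls X i (column_class X y) = map_option (column_class X) (e_col X (column_pattern X)
    i y)"
proof -
  obtain n where n: "(SOME z. z \<in> column_class X y) = shift X n y" by (rule some_in_column_class)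
  have "column_class X (shift X n z) = column_class X z" if "e_col X (column_pattern X) i y =
    Some z" for z
    using e_col_column(2)[OF y that] remove_column column_class_shift by blast
  then show ?thesis
    using e_col_carries[OF carries_period well_formed_column y, of i n]
    unfolding e_cls_def n
    by (cases "e_col X (column_pattern X) i y") (simp_all add: shift_def)
qed

section \<open>String lengths and the tensor product rule\<close>

lemma string_length_None:
  assumes "op x = None" shows "string_length op x = 0"
proof -
  have "((\<lambda>z. Option.bind z op) ^^ m) None = None" for m by (induction m) auto
  then have "((\<lambda>z. Option.bind z op) ^^ m) (Some x) \<noteq> None \<longleftrightarrow> m = 0" for m
    using assms by (cases m) (auto simp: funpow_Suc_right simp del: funpow.simps(2))
  then show ?thesis by (simp add: string_length_def)
qed

lemma string_length_Some:
  assumes "op x = Some y" "op y = None" shows "string_length op x = 1"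
proof -
  have none: "((\<lambda>z. Option.bind z op) ^^ m) None = None" for m by (induction m) auto
  then have "((\<lambda>z. Option.bind z op) ^^ m) (Some y) \<noteq> None \<longleftrightarrow> m = 0" for m
    using assms by (cases m) (auto simp: funpow_Suc_right simp del: funpow.simps(2))
  then have "((\<lambda>z. Option.bind z op) ^^ m) (Some x) \<noteq> None \<longleftrightarrow> m = 0 \<or> m = 1" for m
    using assms(1) by (cases m) (auto simp: funpow_Suc_right simp del: funpow.simps(2))
  then have "{m. ((\<lambda>z. Option.bind z op) ^^ m) (Some x) \<noteq> None} = {0, 1}" by blast
  then show ?thesis by (simp add: string_length_def)
qed

lemma f_cls_add:
  "column X y \<Longrightarrow> add_block X i y b \<Longrightarrow> f_cls X i (column_class X y) =
    Some (column_class X (insert b y))"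
  by (simp add: f_cls_column_class f_col_column(1))

lemma f_cls_no_add: "column X y \<Longrightarrow> (\<And>b. \<not> add_block X i y b) \<Longrightarrow> f_cls X i (column_class X y) = None"
  by (simp add: f_cls_column_class f_col_None)

lemma e_cls_remove:
  "column X y \<Longrightarrow> remove_block X i y b \<Longrightarrow> e_cls X i (column_class X y) =
    Some (column_class X (y - {b}))"
  by (simp add: e_cls_column_class e_col_column(1))

lemma e_cls_no_remove:
  "column X y \<Longrightarrow> (\<And>b. \<not> remove_block X i y b) \<Longrightarrow> e_cls X i (column_class X y) = None"
  by (simp add: e_cls_column_class e_col_None)

lemma phi_column_class:
  assumes y: "column X y"
  shows "phi X i (column_class X y) = (if \<exists>b. add_block X i y b then 1 else 0)"
proof (cases "\<exists>b. add_block X i y b")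
  case True
  then obtain b where b: "add_block X i y b" by blast
  have "f_cls X i (column_class X (insert b y)) = None"
    using add_not_remove[OF add_column[OF b] _ add_imp_remove[OF y b]]
    by (intro f_cls_no_add add_column[OF b]) blast
  then show ?thesis
    using True f_cls_add[OF y b] by (simp add: phi_def string_length_Some)
next
  case False
  then show ?thesis using f_cls_no_add[OF y] by (simp add: phi_def string_length_None)
qed

lemma eps_column_class:
  assumes y: "column X y"
  shows "eps X i (column_class X y) = (if \<exists>b. remove_block X i y b then 1 else 0)"
proof (cases "\<exists>b. remove_block X i y b")
  case True
  then obtain b where b: "remove_block X i y b" by blast
  have "e_cls X i (column_class X (y - {b})) = None"
    using add_not_remove[OF remove_column[OF b] remove_imp_add[OF y b]]
    by (intro e_cls_no_remove remove_column[OF b]) blast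
  then show ?thesis
    using True e_cls_remove[OF y b] by (simp add: eps_def string_length_Some)
next
  case False
  then show ?thesis using e_cls_no_remove[OF y] by (simp add: eps_def string_length_None)
qed

lemma f_tensor_left:
  assumes "column X a" "column X b" "add_block X i a x" "\<And>z. \<not> remove_block X i b z"
  shows "f_tensor X i (column_class X a, column_class X b) =
    Some (column_class X (insert x a), column_class X b)"
  using assms by (auto simp: f_tensor_def phi_column_class eps_column_class f_cls_add)

lemma f_tensor_right:
  assumes "column X a" "column X b" "add_block X i b x"
    and "(\<And>z. \<not> add_block X i a z)"
  shows "f_tensor X i (column_class X a, column_class X b) =
    Some (column_class X a, column_class X (insert x b))"
  using assms by (auto simp: f_tensor_def phi_column_class eps_column_class f_cls_add)

text \<open>Since \<open>phi\<close> and \<open>eps\<close> are 0 or 1, the left factor moves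
  exactly when \<open>a\<close> has an addable and \<open>b\<close> no removable
  \<open>i\<close>-block. In the other case the addable block of \<open>b\<close> excludes a
  removable one there, so \<open>a\<close> cannot have an addable one.\<close>

lemma f_tensor_cases:
  assumes ab: "column X a" "column X b"
    and p: "f_tensor X i (column_class X a, column_class X b) = Some p"
  obtains (left) x where "add_block X i a x" "\<And>z. \<not> remove_block X i b z"
      "p = (column_class X (insert x a), column_class X b)"
  | (right) x where "add_block X i b x" "\<And>z. \<not> add_block X i a z"
      "p = (column_class X a, column_class X (insert x b))"
proof (cases "(\<exists>x. add_block X i a x) \<and> (\<forall>z. \<not> remove_block X i b z)")
  case True
  then obtain x where x: "add_block X i a x" "\<And>z. \<not> remove_block X i b z" by blast
  with f_tensor_left[OF ab x] p show ?thesis by (intro left) auto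
next
  case False
  then have p': "map_option (\<lambda>d. (column_class X a, d)) (f_cls X i (column_class X b)) = Some p"
    using p ab by (auto simp: f_tensor_def phi_column_class eps_column_class split: if_splits)
  have "\<exists>x. add_block X i b x"
    using p' f_cls_no_add[OF ab(2)] by fastforce
  then obtain x where x: "add_block X i b x" by blast
  then have "\<not> remove_block X i b z" for z using add_not_remove ab by blast
  then have "\<not> add_block X i a z" for z using False by blast
  with x p' f_cls_add[OF ab(2) x] show ?thesis by (intro right) auto
qed

text \<open>Colour 0 occurs once per step of \<tau>, at heights congruent to 1 modulo the height
  \<delta> of \<tau>. Other colours, such as 4, form several orbits, which makes 0-blocks the
  natural reference.\<close>

lemma zero_blocks_orbit:
  assumes "colour_block X 0 b" "colour_block X 0 c"
  obtains n where "c = shift_block X n b"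
proof -
  define \<delta> where "\<delta> = fst (period_motion X 1)"
  have \<delta>: "fst (period_motion X n) = \<delta> * n" for n by (cases X) (simp_all add: \<delta>_def)
  have "\<forall>q\<in>set [0..<period X]. 0 \<in> set (word X q) \<longrightarrow> int q mod \<delta> = 0"
    by (cases X) (simp_all add: \<delta>_def word_def upt_conv_Cons del: set_upt)
  then have zero: "0 \<in> set (word X q) \<Longrightarrow> q < period X \<Longrightarrow> int q mod \<delta> = 0" for q
    unfolding set_upt by simp
  have per: "int (period X) mod \<delta> = 0" by (cases X) (simp_all add: \<delta>_def)
  have "(fst d - 1) mod \<delta> = 0" if "colour_block X 0 d" for d
  proof -
    have "int (phase X (fst d)) mod \<delta> = 0"
      using that zero phase_less by (simp add: colour_block_iff)
    then show ?thesis using per by (simp add: phase_def mod_mod_cancel dvd_eq_mod_eq_0)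
  qed
  then have "\<delta> dvd fst c - 1" "\<delta> dvd fst b - 1"
    using assms dvd_eq_mod_eq_0 by blast+
  then have "\<delta> dvd (fst c - 1) - (fst b - 1)"
    by (rule dvd_diff)
  then obtain n where n: "fst c = fst b + \<delta> * n"
    by (auto simp: dvd_def algebra_simps)
  have "colour_block X 0 (shift_block X n b)"
    using shift_colour_block[OF block_cells[OF colour_block_is_block[OF assms(1)]]] assms(1) by
      blast
  then have "c = shift_block X n b"
    using assms(2) n \<delta> by (simp add: colour_block_iff move_block_def)
  then show ?thesis by (rule that)
qed

section \<open>The energy function\<close>

definition cut :: "(int \<Rightarrow> bool) \<Rightarrow> int" where
  "cut P = (THE h. \<forall>k. h \<le> k \<longleftrightarrow> P k)"

lemma int_eq_by_le: "(\<And>k. (x :: int) \<le> k \<longleftrightarrow> y \<le> k) \<Longrightarrow> x = y"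
  by (meson antisym order_refl)

lemma cut_le_iff:
  assumes mono: "\<And>k l. P k \<Longrightarrow> k \<le> l \<Longrightarrow> P l" and u: "P u" and l: "\<not> P l"
  shows "cut P \<le> k \<longleftrightarrow> P k"
proof -
  have gt: "l < k" if "P k" for k using mono[OF that, of l] l by fastforce
  \<comment> \<open>The minimum is sought among the natural distances from the failing
    \<open>l\<close>, since nothing up to \<open>l\<close> satisfies \<open>P\<close>.\<close>
  define n where "n = (LEAST n. P (l + int n))"
  have ex: "P (l + int (nat (u - l)))" using u gt[OF u] by simp
  have n: "P (l + int n)" unfolding n_def using ex by (rule LeastI)
  have all: "l + int n \<le> k \<longleftrightarrow> P k" for k
  proof
    assume "P k"
    then have "P (l + int (nat (k - l)))" using gt[of k] by simp
    then have "n \<le> nat (k - l)" unfolding n_def by (rule Least_le)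
    then show "l + int n \<le> k" using gt[OF \<open>P k\<close>] by linarith
  qed (use mono n in blast)
  have "cut P = l + int n"
    unfolding cut_def
  proof (rule the_equality)
    fix h assume "\<forall>k. h \<le> k \<longleftrightarrow> P k"
    then show "h = l + int n" using all by (intro int_eq_by_le) simp
  qed (use all in blast)
  then show ?thesis using all by simp
qed

definition offset :: "affine_type \<Rightarrow> block set \<Rightarrow> block set \<Rightarrow> int" where
  "offset X a b = cut (\<lambda>k. b \<subseteq> shift X k a)"

lemma fst_period_motion_ge: "0 \<le> n \<Longrightarrow> n \<le> fst (period_motion X n)"
  by (cases X) auto

lemma fst_period_motion_minus: "fst (period_motion X (- n)) = - fst (period_motion X n)"
  by (cases X) auto

lemma offset_le_iff:
  assumes a: "column X a" and b: "column X b"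
  shows "offset X a b \<le> k \<longleftrightarrow> b \<subseteq> shift X k a"
proof -
  have mono: "b \<subseteq> shift X l a" if "b \<subseteq> shift X k a" "k \<le> l" for k l
    using shift_le[OF a that(2)] that(1) by blast
  obtain h where h: "\<And>c. c \<in> b \<Longrightarrow> fst c \<le> h" using column_high[OF b] by blast
  obtain l where l: "\<And>c. column_block X c \<Longrightarrow> fst c \<le> l \<Longrightarrow> c \<in> a" using column_low[OF a] by blast
  \<comment> \<open>The power \<open>n \<ge> 0\<close> of \<tau> raises heights by at least
    \<open>n\<close>. Hence the inverse of the power \<open>?u\<close> brings the blocks of
    \<open>b\<close>, which reach at most height \<open>h\<close>, down to height \<open>l\<close>,
    where \<open>a\<close> contains everything.\<close>
  let ?u = "max 0 (h - l)"
  have u: "b \<subseteq> shift X ?u a"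
  proof
    fix c assume c: "c \<in> b"
    have cc: "snd c \<subseteq> cells X" using column_cells[OF b c] .
    have "fst (shift_block X (- ?u) c) \<le> l"
      using h[OF c] fst_period_motion_ge[of ?u X] fst_period_motion_minus[of X ?u]
      by (simp add: move_block_def)
    moreover have "column_block X (shift_block X (- ?u) c)"
      using carries_block[OF carries_period well_formed_column cc] column_block_in[OF b c] by blast
    ultimately show "c \<in> shift X ?u a" using l in_shift_iff[OF a cc] by blast
  qed
  obtain h' where h': "\<And>c. c \<in> a \<Longrightarrow> fst c \<le> h'" using column_high[OF a] by blast
  obtain c where c: "c \<in> b" using b by (auto simp: column_iff)
  let ?v = "max 0 (h' - fst c + 1)"
  have "\<not> b \<subseteq> shift X (- ?v) a"
  proof
    assume "b \<subseteq> shift X (- ?v) a"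
    then have "shift_block X ?v c \<in> a"
      using in_shift_iff[OF a column_cells[OF b c], of "- ?v"] c by auto
    then have "fst c + fst (period_motion X ?v) \<le> h'" using h' by (fastforce simp: move_block_def)
    then show False using fst_period_motion_ge[of ?v X] by linarith
  qed
  from cut_le_iff[of "\<lambda>k. b \<subseteq> shift X k a", OF mono u this] show ?thesis
    by (simp add: offset_def)
qed

lemma offset_shift_left:
  assumes "column X a" "column X b"
  shows "offset X (shift X n a) b = offset X a b - n"
proof (rule int_eq_by_le)
  fix k
  show "offset X (shift X n a) b \<le> k \<longleftrightarrow> offset X a b - n \<le> k"
    using offset_le_iff[OF column_shift[OF assms(1)] assms(2)] offset_le_iff[OF assms, of "k + n"]
      shift_shift[OF assms(1)] by auto
qed

lemma offset_shift_right:
  assumes "column X a" "column X b"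
  shows "offset X a (shift X n b) = offset X a b + n"
proof (rule int_eq_by_le)
  fix k
  have "shift X n b \<subseteq> shift X k a \<longleftrightarrow> b \<subseteq> shift X (k - n) a"
    using shift_subset_shift[OF assms(2) column_shift[OF assms(1)], of n "k - n"] shift_shift[OF
      assms(1)]
    by simp
  then show "offset X a (shift X n b) \<le> k \<longleftrightarrow> offset X a b + n \<le> k"
    using offset_le_iff[OF assms(1) column_shift[OF assms(2)]] offset_le_iff[OF assms, of "k -
      n"] by auto
qed

lemma offset_self:
  assumes a: "column X a"
  shows "offset X a a = 0"
proof -
  have "\<not> a \<subseteq> shift X (- 1) a"
  proof
    assume s: "a \<subseteq> shift X (- 1) a"
    have "a \<subseteq> shift X (offset X a a) a" using offset_le_iff[OF a a] by blast
    also have "\<dots> \<subseteq> shift X (offset X a a - 1) a"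
      using shift_mono[OF s, of X "offset X a a"] shift_shift[OF a] by simp
    finally show False using offset_le_iff[OF a a, of "offset X a a - 1"] by simp
  qed
  then show ?thesis using offset_le_iff[OF a a, of "- 1"] offset_le_iff[OF a a, of 0] by simp
qed

text \<open>The offset can only change if \<open>b\<close> needs the translate \<open>?x\<close> of
  the new block. Nothing in \<open>b\<close> covers \<open>?x\<close>, as it would lie in the
  translate of \<open>a\<close> and bring \<open>?x\<close> along; so \<open>?x\<close> is a
  removable \<open>i\<close>-block of \<open>b\<close>, which the tensor product rule excludes when
  it acts on the left factor.\<close>

lemma offset_add_left:
  assumes a: "column X a" and b: "column X b" and x: "add_block X i a x"
    and no: "\<And>z. \<not> remove_block X i b z"
  shows "offset X (insert x a) b = offset X a b"
proof (rule int_eq_by_le)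
  fix k
  let ?x = "shift_block X k x"
  have x': "colour_block X i x" "x \<notin> a" using x by (auto simp: add_iff[OF a])
  have cx: "snd x \<subseteq> cells X" using block_cells[OF colour_block_is_block[OF x'(1)]] .
  have x_notin: "?x \<notin> shift X k a"
    using in_shift_iff[OF a move_cells[OF cx]] x'(2) cx by (simp add: shift_block_shift_block)
  have "b \<subseteq> shift X k a" if sub: "b \<subseteq> shift X k (insert x a)"
  proof (rule ccontr)
    assume "\<not> b \<subseteq> shift X k a"
    then have "?x \<in> b" using sub by (auto simp: shift_def)
    moreover have "\<not> cover X ?x c" if "c \<in> b" for c
    proof
      assume c: "cover X ?x c"
      then have "c \<noteq> ?x" by (auto simp: cover_def)
      then have "c \<in> shift X k a" using sub that by (auto simp: shift_def)
      then show False using column_cover[OF column_shift[OF a] c] x_notin by blast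
    qed
    ultimately have "remove_block X i b ?x"
      using shift_colour_block[OF cx] x'(1) by (auto simp: remove_iff[OF b])
    then show False using no by blast
  qed
  moreover have "shift X k a \<subseteq> shift X k (insert x a)" by (rule shift_mono) blast
  ultimately show "offset X (insert x a) b \<le> k \<longleftrightarrow> offset X a b \<le> k"
    using offset_le_iff[OF add_column[OF x] b] offset_le_iff[OF a b] by blast
qed

text \<open>Dual to \<open>offset_add_left\<close>: if \<open>y\<close> were missing from a
  translate of \<open>a\<close> that contains \<open>b\<close>, its supports would be there, so it
  would be addable to that translate, and \<open>a\<close> would have an addable
  \<open>i\<close>-block.\<close>

lemma offset_add_right:
  assumes a: "column X a" and b: "column X b" and y: "add_block X i b y"
    and no: "\<And>z. \<not> add_block X i a z"
  shows "offset X a (insert y b) = offset X a b"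
proof (rule int_eq_by_le)
  fix k
  have y': "colour_block X i y" "\<And>c. cover X c y \<Longrightarrow> c \<in> b" using y by (auto simp: add_iff[OF b])
  have cy: "snd y \<subseteq> cells X" using block_cells[OF colour_block_is_block[OF y'(1)]] .
  have "y \<in> shift X k a" if sub: "b \<subseteq> shift X k a"
  proof (rule ccontr)
    assume "y \<notin> shift X k a"
    then have "add_block X i (shift X k a) y"
      using y' sub by (auto simp: add_iff[OF column_shift[OF a]])
    then have "add_block X i (shift X k a) (shift_block X k (shift_block X (- k) y))"
      by (simp add: shift_block_shift_block[OF cy])
    then show False using add_shift[OF a move_cells[OF cy]] no by blast
  qed
  then show "offset X a (insert y b) \<le> k \<longleftrightarrow> offset X a b \<le> k"
    using offset_le_iff[OF a add_column[OF y]] offset_le_iff[OF a b] by blast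
qed

section \<open>The level of a column\<close>

definition base :: "affine_type \<Rightarrow> block" where
  "base X = block_of X 1 0"

lemma base: "colour_block X 0 (base X)"
proof -
  have "phase X 1 = 0" by (simp add: phase_def)
  moreover have "0 \<in> set (word X 0)" by (cases X) (simp_all add: word_def)
  ultimately show ?thesis by (simp add: colour_block_iff base_def)
qed

lemma base_cells: "snd (base X) \<subseteq> cells X"
  by (rule block_cells[OF colour_block_is_block[OF base]])

text \<open>\<open>level\<close> counts, with a minus sign, the 0-blocks of a column.\<close>

definition level :: "affine_type \<Rightarrow> block set \<Rightarrow> int" where
  "level X a = offset X a {c. below X c (base X)}"

lemma column_origin: "column X {c. below X c (base X)}"
  by (rule column_down[OF colour_block_is_block[OF base]])

lemma down_subset_iff: "column X a \<Longrightarrow> {c. below X c b} \<subseteq> a \<longleftrightarrow> b \<in> a"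
  using column_below by blast

lemma level_le_iff:
  assumes a: "column X a"
  shows "level X a \<le> k \<longleftrightarrow> shift_block X (- k) (base X) \<in> a"
  unfolding level_def offset_le_iff[OF a column_origin] down_subset_iff[OF column_shift[OF a]]
    in_shift_iff[OF a base_cells] ..

lemma level_shift: "column X a \<Longrightarrow> level X (shift X n a) = level X a - n"
  unfolding level_def by (rule offset_shift_left[OF _ column_origin])

lemma remove_down:
  assumes "column_block X b" "remove_block X i {c. below X c b} z"
  shows "z = b"
proof -
  have z: "below X z b" "\<And>c. below X c b \<Longrightarrow> \<not> cover X z c"
    using assms(2) by (auto simp: remove_iff[OF column_down[OF assms(1)]])
  from z(1) show ?thesis
    by (cases rule: converse_rtranclpE) (use z(2) in auto)
qed

text \<open>The ideal below \<open>base X\<close> has \<open>base X\<close> as its only removable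
  block, hence none of colour \<open>i\<close>, and \<open>offset_add_left\<close> applies.\<close>

lemma level_add_other:
  assumes a: "column X a" and x: "add_block X i a x" and "i \<noteq> 0"
  shows "level X (insert x a) = level X a"
  unfolding level_def
proof (rule offset_add_left[OF a column_origin x])
  fix z
  show "\<not> remove_block X i {c. below X c (base X)} z"
    using remove_down[OF colour_block_is_block[OF base]] colour_block_unique[OF _ base] \<open>i \<noteq> 0\<close>
    by (metis removable_def)
qed

lemma shift_base_below:
  assumes "m \<le> n" shows "below X (shift_block X m (base X)) (shift_block X n (base X))"
proof -
  have "column_block X (shift_block X m (base X))"
    using shift_colour_block[OF base_cells] base colour_block_is_block by blast
  from below_shift_block[OF this, of "n - m"] show ?thesis
    using assms by (simp add: shift_block_shift_block[OF base_cells])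
qed

text \<open>The 0-blocks are the chain of translates of \<open>base X\<close>. The column contains
  exactly those before the added one, so the threshold read off by \<open>level_le_iff\<close> drops
  by one.\<close>

lemma level_add_zero:
  assumes a: "column X a" and x: "add_block X 0 a x"
  shows "level X (insert x a) = level X a - 1"
proof -
  have x': "colour_block X 0 x" "x \<notin> a" "\<And>d. cover X d x \<Longrightarrow> d \<in> a"
    using x by (auto simp: add_iff[OF a])
  obtain n where n: "x = shift_block X n (base X)"
    using zero_blocks_orbit[OF base x'(1)] by blast
  have inj: "m = n" if "shift_block X m (base X) = x" for m
  proof -
    have "fst (period_motion X m) = fst (period_motion X n)"
      using that n by (simp add: move_block_def)
    then show ?thesis by (cases X) auto
  qed
  have in_a: "shift_block X m (base X) \<in> a \<longleftrightarrow> m < n" for m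
  proof
    assume m: "shift_block X m (base X) \<in> a"
    show "m < n"
    proof (rule ccontr)
      assume "\<not> m < n"
      then have "below X x (shift_block X m (base X))" using shift_base_below[of n m X] n by simp
      then show False using column_below a m x'(2) by blast
    qed
  next
    assume m: "m < n"
    then have "below X (shift_block X m (base X)) x" using shift_base_below[of m n X] n by simp
    then show "shift_block X m (base X) \<in> a"
    proof (cases rule: rtranclp.cases)
      case rtrancl_refl
      then show ?thesis using inj m by blast
    next
      case (rtrancl_into_rtrancl d)
      then show ?thesis using x'(3) column_below a by blast
    qed
  qed
  have "level X (insert x a) \<le> k \<longleftrightarrow> level X a - 1 \<le> k" for k
  proof -
    have "shift_block X (- k) (base X) \<in> insert x a \<longleftrightarrow> - k \<le> n"
      using in_a[of "- k"] inj[of "- k"] n by auto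
    moreover have "shift_block X (- (k + 1)) (base X) \<in> a \<longleftrightarrow> - k \<le> n"
      using in_a[of "- (k + 1)"] by auto
    ultimately show ?thesis
      using level_le_iff[OF add_column[OF x], of k] level_le_iff[OF a, of "k + 1"] by auto
  qed
  then show ?thesis by (rule int_eq_by_le)
qed

text \<open>Chosen so that \<open>offset X a b\<close> is the affine energy of the classes of
  \<open>a\<close> and \<open>b\<close> with exponents \<open>level X a\<close> and
  \<open>level X b\<close>. As the offset is invariant, the prescribed changes by 1 under colour 0
  come from the levels.\<close>

definition explicit_energy :: "affine_type \<Rightarrow> yclass \<times> yclass \<Rightarrow> int" where
  "explicit_energy X = (\<lambda>(c, d).
     let a = (SOME z. z \<in> c); b = (SOME z. z \<in> d) in offset X a b - level X a + level X b)"

lemma explicit_energy_column_class: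
  assumes "column X a" "column X b"
  shows "explicit_energy X (column_class X a, column_class X b) =
    offset X a b - level X a + level X b"
proof -
  obtain m where m: "(SOME z. z \<in> column_class X a) = shift X m a" by (rule some_in_column_class)
  obtain n where n: "(SOME z. z \<in> column_class X b) = shift X n b" by (rule some_in_column_class)
  show ?thesis
    by (simp add: explicit_energy_def m n offset_shift_left offset_shift_right level_shift
      column_shift assms)
qed

text \<open>\<open>is_energy\<close> tells the factor acted on only by the resulting pair. An
  operator fixing a class could make an action on the left look like one on the right; this excludes
  it.\<close>

lemma f_cls_class_neq:
  assumes "column X a" "add_block X i a x"
  shows "column_class X (insert x a) \<noteq> column_class X a"
proof -
  have "f_cls X i (column_class X (insert x a)) = None"
    using add_not_remove[OF add_column[OF assms(2)] _ add_imp_remove[OF assms]]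
    by (intro f_cls_no_add add_column[OF assms(2)]) blast
  then show ?thesis using f_cls_add[OF assms] by auto
qed

lemma is_energy_explicit_energy: "is_energy X (explicit_energy X)"
  unfolding is_energy_def
proof (intro conjI ballI allI impI)
  fix i c d p
  assume cd: "c \<in> crystal X" "d \<in> crystal X" and p: "i \<noteq> 0 \<and> f_tensor X i (c, d) = Some p"
  obtain a b where a: "column X a" "c = column_class X a" and b: "column X b" "d = column_class X b"
    using cd crystalE by metis
  from p a b have "f_tensor X i (column_class X a, column_class X b) = Some p" by simp
  with a(1) b(1) show "explicit_energy X p = explicit_energy X (c, d)"
  proof (cases rule: f_tensor_cases)
    case (left x)
    then show ?thesis
      using p a b add_column[OF left(1)]
      by (simp add: explicit_energy_column_class offset_add_left level_add_other)
  next
    case (right x)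
    then show ?thesis
      using p a b add_column[OF right(1)]
      by (simp add: explicit_energy_column_class offset_add_right level_add_other)
  qed
next
  fix c d e
  assume cd: "c \<in> crystal X" "d \<in> crystal X"
    and p: "f_tensor X 0 (c, d) = Some (e, d) \<and> f_cls X 0 c = Some e"
  obtain a b where a: "column X a" "c = column_class X a" and b: "column X b" "d = column_class X b"
    using cd crystalE by metis
  from p a b have "f_tensor X 0 (column_class X a, column_class X b) = Some (e, d)" by simp
  with a(1) b(1) show "explicit_energy X (e, d) = explicit_energy X (c, d) + 1"
  proof (cases rule: f_tensor_cases)
    case (left x)
    then show ?thesis
      using a b add_column[OF left(1)]
      by (simp add: explicit_energy_column_class offset_add_left level_add_zero)
  next
    case (right x)
    then show ?thesis using p a f_cls_no_add[of X a 0] by simp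
  qed
next
  fix c d e
  assume cd: "c \<in> crystal X" "d \<in> crystal X"
    and p: "f_tensor X 0 (c, d) = Some (c, e) \<and> f_cls X 0 d = Some e"
  obtain a b where a: "column X a" "c = column_class X a" and b: "column X b" "d = column_class X b"
    using cd crystalE by metis
  from p a b have "f_tensor X 0 (column_class X a, column_class X b) = Some (c, e)" by simp
  with a(1) b(1) show "explicit_energy X (c, e) = explicit_energy X (c, d) - 1"
  proof (cases rule: f_tensor_cases)
    case (left x)
    then show ?thesis using a f_cls_class_neq[OF a(1) left(1)] by simp
  next
    case (right x)
    then show ?thesis
      using a b add_column[OF right(1)]
      by (simp add: explicit_energy_column_class offset_add_right level_add_zero)
  qed
next
  fix c assume "c \<in> crystal X"
  then obtain a where "column X a" "c = column_class X a" by (rule crystalE)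
  then show "explicit_energy X (c, c) = 0"
    by (simp add: explicit_energy_column_class offset_self)
qed

section \<open>Uniqueness of the energy function\<close>

lemma colour_index:
  assumes "colour_block X i b" shows "i \<in> index_set X"
proof -
  have "\<forall>w\<in>set (words X). \<forall>i\<in>set w. i \<le> rank_of X"
    by (cases X) simp_all
  moreover have "length (words X) = period X"
    by (cases X) simp_all
  then have "word X q \<in> set (words X)" for q
    by (simp add: word_def nth_mem)
  ultimately show ?thesis
    using assms by (auto simp: colour_block_iff index_set_def)
qed

text \<open>The difference between a candidate \<open>H\<close> and the explicit energy, kept on
  columns so that inclusions between representatives can be used. Crystal moves leave it unchanged
  for an energy function; uniqueness means that it vanishes.\<close>

definition defect :: "affine_type \<Rightarrow> (yclass \<times> yclass \<Rightarrow> int) \<Rightarrow> block set \<Rightarrow> block set \<Rightarrow> int" where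
  "defect X H a b = H (column_class X a, column_class X b) + level X a - level X b - offset X a b"

lemma defect_shift_left: "column X a \<Longrightarrow> column X b \<Longrightarrow> defect X H (shift X n a) b = defect X H a b"
  by (simp add: defect_def column_class_shift level_shift offset_shift_left)

lemma defect_shift_self:
  "is_energy X H \<Longrightarrow> column X a \<Longrightarrow> defect X H a (shift X n a) = 0"
  by (simp add: defect_def column_class_shift level_shift offset_shift_right offset_self
    is_energy_def
      column_class_crystal)

lemma defect_add_left:
  assumes H: "is_energy X H" and a: "column X a" and b: "column X b" and x: "add_block X i a x"
    and no: "\<And>z. \<not> remove_block X i b z"
  shows "defect X H (insert x a) b = defect X H a b"
proof -
  have i: "i \<in> index_set X" using x colour_index unfolding addable_def by blast
  have t: "f_tensor X i (column_class X a, column_class X b) =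
    Some (column_class X (insert x a), column_class X b)"
    by (rule f_tensor_left[OF a b x no])
  have "H (column_class X (insert x a), column_class X b) =
      H (column_class X a, column_class X b) + (if i = 0 then 1 else 0)"
    using H t i f_cls_add[OF a x] column_class_crystal[OF a] column_class_crystal[OF b]
    unfolding is_energy_def by auto
  then show ?thesis
    using offset_add_left[OF a b x no] level_add_other[OF a x] level_add_zero[OF a, of x] x
    by (cases "i = 0") (simp_all add: defect_def)
qed

lemma defect_add_right:
  assumes H: "is_energy X H" and a: "column X a" and b: "column X b" and y: "add_block X i b y"
    and no: "\<And>z. \<not> add_block X i a z"
  shows "defect X H a (insert y b) = defect X H a b"
proof -
  have i: "i \<in> index_set X" using y colour_index unfolding addable_def by blast
  have t: "f_tensor X i (column_class X a, column_class X b) =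
    Some (column_class X a, column_class X (insert y b))"
    by (rule f_tensor_right[OF a b y no])
  have "H (column_class X a, column_class X (insert y b)) =
      H (column_class X a, column_class X b) - (if i = 0 then 1 else 0)"
    using H t i f_cls_add[OF b y] column_class_crystal[OF a] column_class_crystal[OF b]
    unfolding is_energy_def by auto
  then show ?thesis
    using offset_add_right[OF a b y no] level_add_other[OF b y] level_add_zero[OF b, of y] y
    by (cases "i = 0") (simp_all add: defect_def)
qed

lemma exists_colour_in_column:
  assumes "column X a" "column X b" "z \<in> b" "colour_block X j z"
  obtains w where "w \<in> a" "colour_block X j w"
proof -
  have c: "snd z \<subseteq> cells X" using column_cells[OF assms(2,3)] .
  have "b \<subseteq> shift X (offset X a b) a" using offset_le_iff[OF assms(1,2)] by blast
  then have "shift_block X (- offset X a b) z \<in> a"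
    using in_shift_iff[OF assms(1) c] assms(3) by blast
  then show ?thesis using that shift_colour_block[OF c] assms(4) by blast
qed

lemma maximal_incomparable:
  assumes "column X b" "remove_block X i b y" "remove_block X j b z" "i = j \<or> adjacent X i j"
  shows "y = z"
proof -
  have *: "y = z" if "below X y z" "remove_block X i b y" "remove_block X j b z" for i j y z
    using that(1)
  proof (cases rule: converse_rtranclpE)
    case (step d)
    then have "d \<in> b" using that(3) column_below assms(1) by (auto simp: remove_iff[OF assms(1)])
    then show ?thesis using that(2) step(1) by (auto simp: remove_iff[OF assms(1)])
  qed
  have "below X y z \<or> below X z y"
    using comparable[of X i y j z] assms by (auto simp: remove_iff[OF assms(1)])
  then show ?thesis using *[OF _ assms(2,3)] *[OF _ assms(3,2)] by blast
qed

text \<open>The removable colours of \<open>a\<close> are removable in \<open>b\<close>, and this persists under removal, by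
  the induction hypothesis \<open>small\<close>. If \<open>j\<close> were removable in \<open>b\<close> but not in \<open>a\<close>, remove blocks
  of \<open>a\<close> until a \<open>j\<close>-block gets uncovered; the last block removed has a colour adjacent to \<open>j\<close>,
  and blocks of two adjacent colours are never both maximal in \<open>b\<close>.\<close>

lemma defect_zero_subset:
  assumes H: "is_energy X H"
  shows "column X a \<Longrightarrow> column X b \<Longrightarrow> b \<subseteq> a \<Longrightarrow> card (a - b) = n \<Longrightarrow> defect X H a b = 0"
proof (induction n arbitrary: a b rule: less_induct)
  case (less n)
  note small = less.IH
  \<comment> \<open>A counterexample at the current size; smaller differences are settled by
    \<open>small\<close>.\<close>
  define bad where "bad a b \<longleftrightarrow>
    column X a \<and> column X b \<and> b \<subseteq> a \<and> card (a - b) = n \<and> defect X H a b \<noteq> 0" for a b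
  \<comment> \<open>When \<open>x\<close> leaves \<open>a\<close>, a block of the same colour must
    be removable from \<open>b\<close>: otherwise the left factor alone moves and the difference
    shrinks. The pair obtained is again a counterexample, of the same size.\<close>
  have peel: "\<exists>y. remove_block X i b y \<and> bad (a - {x}) (b - {y})"
    if bad: "bad a b" and x: "remove_block X i a x" for a b i x
  proof -
    have a: "column X a" and b: "column X b" and ba: "b \<subseteq> a" and n: "card (a - b) = n"
      and d: "defect X H a b \<noteq> 0"
      using bad by (auto simp: bad_def)
    note fin = finite_column_diff[OF a b]
    have xa: "x \<in> a" "colour_block X i x" "\<And>c. c \<in> a \<Longrightarrow> \<not> cover X x c"
      using x by (auto simp: remove_iff[OF a])
    have xb: "remove_block X i b x" if "x \<in> b"
      using that xa ba by (auto simp: remove_iff[OF b])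
    note a' = remove_column[OF x]
    have ins: "insert x (a - {x}) = a" using xa by blast
    have "\<exists>y. remove_block X i b y"
    proof (rule ccontr)
      assume no: "\<nexists>y. remove_block X i b y"
      then have "x \<notin> b" using xb by blast
      have "defect X H a b = defect X H (a - {x}) b"
        using defect_add_left[OF H a' b remove_imp_add[OF a x]] no ins by auto
      also have "\<dots> = 0"
      proof (rule small)
        have "a - {x} - b = (a - b) - {x}" by blast
        then show "card (a - {x} - b) < n"
          using card_Diff1_less[OF fin, of x] xa \<open>x \<notin> b\<close> n by simp
      qed (use a' b ba \<open>x \<notin> b\<close> in auto)
      finally show False using d by simp
    qed
    then obtain y where y: "remove_block X i b y" by blast
    note b' = remove_column[OF y]
    have yb: "y \<in> b" using y by (simp add: removable_def)
    have ins': "insert y (b - {y}) = b" using yb by blast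
    have no_b': "\<not> remove_block X i (b - {y}) z" for z
      using add_not_remove[OF b' remove_imp_add[OF b y]] by blast
    have no_a: "\<not> add_block X i a z" for z
      using add_not_remove[OF a _ x] by blast
    \<comment> \<open>The order matters: while \<open>x\<close> is removable, nothing of colour
      \<open>i\<close> is addable to \<open>a\<close>, which permits the move on the right; with
      \<open>y\<close> gone, \<open>b\<close> has no removable \<open>i\<close>-block, which permits
      the move on the left.\<close>
    have "defect X H a b = defect X H a (b - {y})"
      using defect_add_right[OF H a b' remove_imp_add[OF b y] no_a] ins' by simp
    also have "\<dots> = defect X H (a - {x}) (b - {y})"
      using defect_add_left[OF H a' b' remove_imp_add[OF a x] no_b'] ins by simp
    finally have "defect X H (a - {x}) (b - {y}) \<noteq> 0" using d by simp
    moreover have "b - {y} \<subseteq> a - {x}"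
      using ba xb remove_unique[OF b y] by blast
    moreover have "card (a - {x} - (b - {y})) = n"
    proof (cases "x \<in> b")
      case True
      then have "x = y" using xb remove_unique[OF b _ y] by blast
      then have "a - {x} - (b - {y}) = a - b" using True by blast
      then show ?thesis using n by simp
    next
      case False
      then have "a - {x} - (b - {y}) = insert y (a - b - {x})" using yb ba by blast
      then have "card (a - {x} - (b - {y})) = Suc (card (a - b - {x}))"
        using fin yb by simp
      also have "\<dots> = card (a - b)"
        using fin False xa by (intro card_Suc_Diff1) auto
      finally show ?thesis using n by simp
    qed
    ultimately show ?thesis using y a' b' by (auto simp: bad_def)
  qed
  have same_colours: "\<exists>v. remove_block X j a v"
    if "bad a b" "remove_block X j b z" "w \<in> a" "colour_block X j w" for a b j w z
    using that
  proof (induction "card (a - {c. below X c w})" arbitrary: a b rule: less_induct)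
    case less
    have a: "column X a" and b: "column X b" using less.prems(1) by (auto simp: bad_def)
    have wblock: "column_block X w" using less.prems(4) by (rule colour_block_is_block)
    show ?case
    proof (rule ccontr)
      assume no: "\<nexists>v. remove_block X j a v"
      \<comment> \<open>If \<open>a\<close> were the ideal of \<open>w\<close>, then
        \<open>w\<close> would be a removable \<open>j\<close>-block; so something not below
        \<open>w\<close> can be removed, and the induction proceeds.\<close>
      have "\<not> cover X w c" if "below X c w" for c
        using below_height[OF that] by (auto simp: cover_def)
      then have "a \<noteq> {c. below X c w}"
        using no less.prems(4) by (auto simp: remove_iff[OF a])
      then have "{c. below X c w} \<subset> a" using column_below a less.prems(3) by blast
      then obtain i x where x: "remove_block X i a x" "\<not> below X x w"
        using exists_remove_diff[OF a column_down[OF wblock]] by blast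
      obtain y where y: "remove_block X i b y" "bad (a - {x}) (b - {y})"
        using peel[OF less.prems(1) x(1)] by blast
      have "i \<noteq> j" using no x by blast
      then have yz: "y \<noteq> z"
        using y(1) less.prems(2) colour_block_unique unfolding removable_def by blast
      then have nadj: "\<not> adjacent X i j"
        using maximal_incomparable[OF b y(1) less.prems(2)] by blast
      have "remove_block X j (b - {y}) z"
        using less.prems(2) yz by (auto simp: remove_iff[OF b] remove_iff[OF remove_column[OF
          y(1)]])
      moreover have "w \<in> a - {x}" using less.prems(3) x(2) by blast
      moreover have "card (a - {x} - {c. below X c w}) < card (a - {c. below X c w})"
      proof -
        have "a - {x} - {c. below X c w} = a - {c. below X c w} - {x}" by blast
        then show ?thesis
          using card_Diff1_less[OF finite_column_diff[OF a column_down[OF wblock]], of x] x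
          by (simp add: removable_def)
      qed
      ultimately obtain v where v: "remove_block X j (a - {x}) v"
        using less.hyps y(2) less.prems(4) by blast
      then have "\<not> remove_block X j a v" using no by blast
      then have "cover X v x"
        using v by (auto simp: remove_iff[OF a] remove_iff[OF remove_column[OF x(1)]])
      then have "adjacent X i j"
        using cover_adjacent v x(1) unfolding removable_def by blast
      then show False using nadj by blast
    qed
  qed
  have principal: "\<exists>b. bad {c. below X c w} b"
    if "bad a b" "w \<in> a" "column_block X w" for a b w
    using that
  proof (induction "card (a - {c. below X c w})" arbitrary: a b rule: less_induct)
    case less
    have a: "column X a" using less.prems(1) by (auto simp: bad_def)
    show ?case
    proof (cases "a = {c. below X c w}")
      case True
      then show ?thesis using less.prems(1) by blast
    next
      case False
      then have "{c. below X c w} \<subset> a" using column_below a less.prems(2) by blast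
      then obtain i x where x: "remove_block X i a x" "\<not> below X x w"
        using exists_remove_diff[OF a column_down[OF less.prems(3)]] by blast
      obtain y where y: "bad (a - {x}) (b - {y})"
        using peel[OF less.prems(1) x(1)] by blast
      have "w \<in> a - {x}" using less.prems(2) x(2) by blast
      moreover have "card (a - {x} - {c. below X c w}) < card (a - {c. below X c w})"
      proof -
        have "a - {x} - {c. below X c w} = a - {c. below X c w} - {x}" by blast
        then show ?thesis
          using card_Diff1_less[OF finite_column_diff[OF a column_down[OF less.prems(3)]], of x] x
          by (simp add: removable_def)
      qed
      ultimately show ?thesis using less.hyps[OF _ y] less.prems(3) by blast
    qed
  qed
  show ?case
  proof (rule ccontr)
    assume "defect X H a b \<noteq> 0"
    then have bad: "bad a b" using less.prems by (simp add: bad_def)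
    \<comment> \<open>A generator of colour 0, so that the two generators found below are related by
      a power of \<tau>.\<close>
    obtain w where w: "w \<in> a" "colour_block X 0 w"
      using exists_colour_in_column[OF less.prems(1) column_origin _ base] by blast
    have wblock: "column_block X w" using w(2) by (rule colour_block_is_block)
    let ?a = "{c. below X c w}"
    obtain b' where bad': "bad ?a b'" using principal[OF bad w(1) wblock] by blast
    have a': "column X ?a" and b': "column X b'" and d: "defect X H ?a b' \<noteq> 0"
      using bad' by (auto simp: bad_def)
    \<comment> \<open>The ideal of \<open>w\<close> has \<open>w\<close> as its only removable
      block, so \<open>same_colours\<close> leaves only colour 0 for \<open>b'\<close>. A removable
      0-block is unique, hence \<open>b'\<close> is generated by one 0-block as well.\<close>
    have zero: "j = 0" if z: "remove_block X j b' z" for j z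
    proof -
      have "z \<in> b'" "colour_block X j z" using z by (auto simp: removable_def)
      then obtain v where "v \<in> ?a" "colour_block X j v"
        using exists_colour_in_column[OF a' b'] by blast
      then obtain u where u: "remove_block X j ?a u"
        using same_colours[OF bad' z] by blast
      then have "u = w" by (rule remove_down[OF wblock])
      then show "j = 0" using u w(2) colour_block_unique unfolding removable_def by blast
    qed
    obtain c where c: "c \<in> b'" using b' by (auto simp: column_iff)
    obtain e where e: "cover X e c" using exists_covered[OF column_block_in[OF b' c]] .
    then have eblock: "column_block X e" by (simp add: cover_def)
    have "\<not> below X c e" using below_height[of X c e] e by (auto simp: cover_def)
    moreover have "e \<in> b'" using column_cover[OF b' e c] .
    ultimately have "{u. below X u e} \<subset> b'" using column_below b' c by blast
    then obtain j z where z: "remove_block X j b' z"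
      using exists_remove_diff[OF b' column_down[OF eblock]] by blast
    then have z0: "remove_block X 0 b' z" using zero by blast
    have zb: "z \<in> b'" and zc: "colour_block X 0 z" using z0 by (auto simp: removable_def)
    have zblock: "column_block X z" using zc by (rule colour_block_is_block)
    have b'_eq: "b' = {u. below X u z}"
    proof (rule ccontr)
      assume "b' \<noteq> {u. below X u z}"
      then have "{u. below X u z} \<subset> b'" using column_below b' zb by blast
      then obtain k v where v: "remove_block X k b' v" "\<not> below X v z"
        using exists_remove_diff[OF b' column_down[OF zblock]] by blast
      then have "v = z" using zero remove_unique[OF b' _ z0] by blast
      then show False using v by blast
    qed
    obtain k where k: "z = shift_block X k w" using zero_blocks_orbit[OF w(2) zc] by blast
    have "z \<in> shift X k ?a" using k by (auto simp: shift_def)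
    then have "b' \<subseteq> shift X k ?a" using down_subset_iff[OF column_shift[OF a']] b'_eq by blast
    moreover have "w \<in> shift X (- k) b'"
      using in_shift_iff[OF b' block_cells[OF wblock]] k zb by simp
    then have "?a \<subseteq> shift X (- k) b'" using down_subset_iff[OF column_shift[OF b']] by blast
    then have "shift X k ?a \<subseteq> b'"
      using shift_mono[of ?a "shift X (- k) b'" X k] shift_shift[OF b'] by simp
    ultimately have "b' = shift X k ?a" by (rule subset_antisym)
    then show False using d defect_shift_self[OF H a'] by simp
  qed
qed

text \<open>Translating \<open>a\<close> does not change the defect, so \<open>a\<close> may be
  assumed to contain \<open>b\<close>, as \<open>defect_zero_subset\<close> requires. The explicit
  energy guarantees that the choice in \<open>energy\<close> is not vacuous.\<close>

lemma energy_column_class: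
  assumes a: "column X a" and b: "column X b"
  shows "energy X (column_class X a, column_class X b) = offset X a b - level X a + level X b"
proof -
  have H: "is_energy X (energy X)"
    unfolding energy_def by (rule someI[of "is_energy X", OF is_energy_explicit_energy])
  have "b \<subseteq> shift X (offset X a b) a" using offset_le_iff[OF a b] by blast
  from defect_zero_subset[OF H column_shift[OF a] b this refl] defect_shift_left[OF a b]
  have "defect X (energy X) a b = 0" by simp
  then show ?thesis by (simp add: defect_def)
qed

section \<open>Walls\<close>

text \<open>The power of \<open>\<tau>\<close> which, after passing from column \<open>r\<close> to column \<open>r + 1\<close>, leaves \<open>\<sigma>\<close>.\<close>

fun lag :: "affine_type \<Rightarrow> int" where
  "lag E6 = - 1"
| "lag E7 = 0"

definition place :: "affine_type \<Rightarrow> nat \<Rightarrow> block set \<Rightarrow> block set" where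
  "place X r y = move_block X (wall_motion X r) ` y"

text \<open>In heights, 8(r + 1) - 6 = 8r + 2 for \<open>E6\<close> and 4(r + 1) = 4r + 4 for
  \<open>E7\<close>.\<close>

lemma wall_motion_Suc:
  "compose_motion (period_motion X (lag X)) (wall_motion X (Suc r)) =
     compose_motion (wall_motion X r) (int (lift X), True)"
  by (cases X) (auto simp: compose_motion_def)

lemma wall_motion_0: "wall_motion X 0 = (0, False)"
  by (cases X) simp_all

lemma column_block_lift:
  "snd b \<subseteq> cells X \<Longrightarrow> column_block X (lift_block X b) \<longleftrightarrow> column_block X b"
  using column_block_lift_iff[of "snd b" X "fst b"] by (simp add: move_block_def)

text \<open>Consecutive columns differ by \<sigma> up to a power of \<tau>. The latter respects
  colours, the former at least the cuts; so block positions, and with them the sets that are Young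
  columns, are the same in all columns.\<close>

lemma is_block_wall: "is_block X (wall_pattern X r) b \<longleftrightarrow> column_block X b"
proof -
  have iff: "is_block X (wall_pattern X r) b \<longleftrightarrow> column_block X (move_block X (wall_motion X r) b)"
    if "snd b \<subseteq> cells X" for r b
    using carries_block[OF carries_wall well_formed_wall that] by blast
  have "snd b \<subseteq> cells X \<Longrightarrow> is_block X (wall_pattern X r) b \<longleftrightarrow> column_block X b" for b
  proof (induction r arbitrary: b)
    case 0
    then show ?case
      using iff[of b 0] by (simp add: wall_motion_0 move_block_def)
  next
    case (Suc r)
    let ?b = "move_block X (wall_motion X (Suc r)) b"
    have cells: "snd (lift_block X b) \<subseteq> cells X" "snd ?b \<subseteq> cells X"
      using Suc.prems by (rule move_cells)+
    have "is_block X (wall_pattern X (Suc r)) b \<longleftrightarrow> column_block X (shift_block X (lag X) ?b)"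
      using iff[OF Suc.prems] carries_block[OF carries_period well_formed_column cells(2)] by simp
    also have "shift_block X (lag X) ?b = move_block X (wall_motion X r) (lift_block X b)"
      using Suc.prems by (simp add: move_compose wall_motion_Suc)
    also have "column_block X \<dots> \<longleftrightarrow> column_block X b"
      using iff[OF cells(1)] Suc.IH[OF cells(1)] column_block_lift[OF Suc.prems] by simp
    finally show ?case .
  qed
  then show ?thesis using block_cells by blast
qed

lemma young_column_wall: "young_column X (wall_pattern X r) y \<longleftrightarrow> column X y"
  by (simp add: young_column_def is_block_wall)

lemma column_place: "column X y \<Longrightarrow> column X (place X r y)"
  unfolding place_def
  by (rule carries_young_column[OF carries_wall well_formed_wall]) (simp add: young_column_wall)

lemma shift_place_Suc:
  assumes "column X y"
  shows "shift X (lag X) (place X (Suc r) y) = place X r (lift_block X ` y)"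
  unfolding shift_def place_def image_image
  using column_cells[OF assms] by (intro image_cong) (simp_all add: move_compose wall_motion_Suc)

lemma place_subset_iff:
  assumes "\<And>b. b \<in> y \<union> y' \<Longrightarrow> snd b \<subseteq> cells X"
  shows "place X r y \<subseteq> place X r y' \<longleftrightarrow> y \<subseteq> y'"
proof -
  have "y \<subseteq> y'" if "place X r y \<subseteq> place X r y'"
  proof
    fix b assume b: "b \<in> y"
    then have "move_block X (wall_motion X r) b \<in> move_block X (wall_motion X r) ` y'"
      using that by (auto simp: place_def)
    then show "b \<in> y'"
      using inj_on_image_mem_iff[OF move_inj_on[of X], of b y'] assms b by blast
  qed
  then show ?thesis by (auto simp: place_def)
qed

lemma place_eq_iff:
  assumes "column X y" "column X y'"
  shows "place X r y = place X r y' \<longleftrightarrow> y = y'"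
proof -
  have "place X r y \<subseteq> place X r y' \<longleftrightarrow> y \<subseteq> y'" "place X r y' \<subseteq> place X r y \<longleftrightarrow> y' \<subseteq> y"
    using column_cells assms by (intro place_subset_iff; blast)+
  then show ?thesis by blast
qed

text \<open>The motions onto the Young column pattern form a coset: any two of them differ by a
  symmetry of that pattern, which is a power of \<tau>.\<close>

lemma class_of_wall:
  assumes y: "column X y"
  shows "class_of X (wall_pattern X r) y = column_class X (place X r y)"
proof -
  have eq: "shift X n (place X r y) = move_block X (compose_motion (period_motion X n)
    (wall_motion X r)) ` y" for n
    unfolding shift_def place_def image_image
    using column_cells[OF y] by (intro image_cong) (simp_all add: move_compose)
  have c: "carries (wall_pattern X r) (column_pattern X) (compose_motion (period_motion X n)
    (wall_motion X r))" for n
    by (rule carries_compose[OF carries_wall carries_period])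
  have "\<exists>n. g = compose_motion (period_motion X n) (wall_motion X r)"
    if g: "carries (wall_pattern X r) (column_pattern X) g" for g
  proof -
    obtain n where n: "compose_motion g (inverse_motion (wall_motion X r)) = period_motion X n"
      using carries_period_only[OF carries_compose[OF carries_inverse[OF carries_wall] g]] by blast
    have "g = compose_motion (compose_motion g (inverse_motion (wall_motion X r))) (wall_motion
      X r)"
      by (cases g) (auto simp: compose_motion_def inverse_motion_def)
    then show ?thesis using n by auto
  qed
  then show ?thesis
    unfolding column_class_eq eq unfolding class_of_def to_column_pattern_carries
    using c by blast
qed

lemma f_col_young: "f_col X P i y = Some z \<Longrightarrow> young_column X P z"
  using someI_ex[of "addable X P i y"] unfolding f_col_def addable_def[of X P i y "Eps _"]
  by (auto split: if_splits)

lemma e_col_young: "e_col X P i y = Some z \<Longrightarrow> young_column X P z"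
  using someI_ex[of "removable X P i y"] unfolding e_col_def removable_def[of X P i y "Eps _"]
  by (auto split: if_splits)

lemma f_col_place:
  "column X y \<Longrightarrow> f_col X (column_pattern X) i (place X r y) =
    map_option (place X r) (f_col X (wall_pattern X r) i y)"
  using f_col_carries[OF carries_wall well_formed_wall, of X r y i]
  by (simp add: young_column_wall place_def[abs_def])

lemma e_col_place:
  "column X y \<Longrightarrow> e_col X (column_pattern X) i (place X r y) =
    map_option (place X r) (e_col X (wall_pattern X r) i y)"
  using e_col_carries[OF carries_wall well_formed_wall, of X r y i]
  by (simp add: young_column_wall place_def[abs_def])

lemma removable_wall:
  assumes y: "column X y" and x: "removable X (wall_pattern X r) i y x"
  shows "e_col X (wall_pattern X r) i y = Some (y - {x})"
    and "f_col X (wall_pattern X r) i (y - {x}) = Some y"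
    and "i \<in> index_set X"
proof -
  let ?P = "wall_pattern X r" and ?x = "move_block X (wall_motion X r) x"
  have col: "is_colour_block X ?P i x" and xy: "x \<in> y" and y': "column X (y - {x})"
    using x by (auto simp: removable_def young_column_wall)
  have cells: "snd x \<subseteq> cells X" using column_cells[OF y xy] .
  have rem: "remove_block X i (place X r y) ?x"
    using carries_removable[OF carries_wall well_formed_wall _ cells, of r y i] y x
    by (simp add: young_column_wall place_def)
  have place_minus: "place X r (y - {x}) = place X r y - {?x}"
    using column_cells[OF y] xy unfolding place_def
    by (subst inj_on_image_set_diff[OF move_inj_on[of X]]) auto
  have "map_option (place X r) (e_col X ?P i y) = Some (place X r (y - {x}))"
    using e_col_place[OF y] e_col_column(1)[OF column_place[OF y] rem] place_minus by simp
  then obtain z where z: "e_col X ?P i y = Some z" "place X r z = place X r (y - {x})" by auto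
  then show "e_col X ?P i y = Some (y - {x})"
    using place_eq_iff[OF _ y'] e_col_young[OF z(1)] by (simp add: young_column_wall)
  have "f_col X (column_pattern X) i (place X r (y - {x})) = Some (place X r y)"
    using f_col_column(1)[OF column_place[OF y'], of i r ?x] remove_imp_add[OF column_place[OF
      y] rem] rem
    by (simp add: place_minus removable_def insert_absorb)
  then have "map_option (place X r) (f_col X ?P i (y - {x})) = Some (place X r y)"
    using f_col_place[OF y'] by simp
  then obtain u where u: "f_col X ?P i (y - {x}) = Some u" "place X r u = place X r y" by auto
  then show "f_col X ?P i (y - {x}) = Some y"
    using place_eq_iff[OF _ y] f_col_young[OF u(1)] by (simp add: young_column_wall)
  show "i \<in> index_set X" using rem colour_index unfolding removable_def by blast
qed

text \<open>Adding a 0-block lowers both the level and the exponent of z by one, so they differ by a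
  constant, which the ground state wall fixes.\<close>

definition explicit_identification :: "affine_type \<Rightarrow> nat \<Rightarrow> block set \<Rightarrow> int \<times> yclass" where
  "explicit_identification X r y =
     (level X (place X r y) + ground_height X r - level X (place X r (ground_wall X r)),
      class_of X (wall_pattern X r) y)"

lemma is_identification_explicit: "is_identification X r (explicit_identification X r)"
  unfolding is_identification_def young_column_wall
proof (intro conjI ballI allI impI)
  let ?\<psi> = "explicit_identification X r"
  let ?c = "ground_height X r - level X (place X r (ground_wall X r))"
  show "?\<psi> (ground_wall X r) = (ground_height X r, ground_class X r)"
    by (simp add: explicit_identification_def ground_class_def)
  show "bij_betw ?\<psi> {y. column X y} (UNIV \<times> crystal X)"
    unfolding bij_betw_def
  proof
    show "inj_on ?\<psi> {y. column X y}"
    proof (rule inj_onI)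
      fix y y' assume "y \<in> {y. column X y}" "y' \<in> {y. column X y}" and eq: "?\<psi> y = ?\<psi> y'"
      then have y: "column X y" and y': "column X y'" by auto
      have "column_class X (place X r y) = column_class X (place X r y')"
        using eq by (simp add: explicit_identification_def class_of_wall y y')
      then obtain n where n: "place X r y' = shift X n (place X r y)"
        using column_class_eq_iff[OF column_place[OF y]] by blast
      then have "n = 0"
        using eq level_shift[OF column_place[OF y]] by (simp add: explicit_identification_def)
      then show "y = y'" using n place_eq_iff[OF y y', of r] by simp
    qed
    show "?\<psi> ` {y. column X y} = UNIV \<times> crystal X"
    proof
      show "?\<psi> ` {y. column X y} \<subseteq> UNIV \<times> crystal X"
        using column_class_crystal column_place by (auto simp: explicit_identification_def
          class_of_wall)
      show "UNIV \<times> crystal X \<subseteq> ?\<psi> ` {y. column X y}"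
      proof
        fix p :: "int \<times> yclass" assume "p \<in> UNIV \<times> crystal X"
        then obtain m z where p: "p = (m, column_class X z)" and z: "column X z"
          by (metis SigmaE crystalE)
        \<comment> \<open>The power \<open>n\<close> of \<tau> lowers the level by \<open>n\<close>,
          so this representative of the class receives exactly the exponent
          \<open>m\<close>.\<close>
        define u where "u = shift X (level X z + ?c - m) z"
        define y where "y = move_block X (inverse_motion (wall_motion X r)) ` u"
        have u: "column X u" unfolding u_def by (rule column_shift[OF z])
        have y: "column X y"
          using carries_young_column[OF carries_inverse[OF carries_wall] well_formed_column u]
          by (simp add: y_def young_column_wall)
        have "place X r y = u"
          unfolding place_def y_def by (rule move_image_inverse'[OF column_cells[OF u]])
        then have "?\<psi> y = p"
          using y z p by (simp add: explicit_identification_def class_of_wall column_class_shift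
            level_shift u_def)
        then show "p \<in> ?\<psi> ` {y. column X y}" using y by blast
      qed
    qed
  qed
  fix i y assume y: "column X y"
  note py = column_place[OF y, of r]
  show "map_option ?\<psi> (f_col X (wall_pattern X r) i y) = f_aff X i (?\<psi> y)"
  proof (cases "f_col X (wall_pattern X r) i y")
    case None
    then show ?thesis
      using f_col_place[OF y, of i r] y
      by (simp add: f_aff_def explicit_identification_def class_of_wall f_cls_column_class py)
  next
    case (Some z)
    then have z: "column X z" using f_col_young by (metis young_column_wall)
    have f: "f_col X (column_pattern X) i (place X r y) = Some (place X r z)"
      using f_col_place[OF y, of i r] Some by simp
    then obtain b where b: "add_block X i (place X r y) b" "place X r z = insert b (place X r y)"
      using f_col_column(2)[OF py] by blast
    have "level X (place X r z) = level X (place X r y) - (if i = 0 then 1 else 0)"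
      using b level_add_zero[OF py, of b] level_add_other[OF py b(1)] by auto
    then show ?thesis
      using Some f y z by (simp add: f_aff_def explicit_identification_def class_of_wall
        f_cls_column_class py)
  qed
  show "map_option ?\<psi> (e_col X (wall_pattern X r) i y) = e_aff X i (?\<psi> y)"
  proof (cases "e_col X (wall_pattern X r) i y")
    case None
    then show ?thesis
      using e_col_place[OF y, of i r] y
      by (simp add: e_aff_def explicit_identification_def class_of_wall e_cls_column_class py)
  next
    case (Some z)
    then have z: "column X z" using e_col_young by (metis young_column_wall)
    have e: "e_col X (column_pattern X) i (place X r y) = Some (place X r z)"
      using e_col_place[OF y, of i r] Some by simp
    then obtain b where b: "remove_block X i (place X r y) b" "place X r z = place X r y - {b}"
      using e_col_column(2)[OF py] by blast
    note pz = column_place[OF z, of r]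
    have add: "add_block X i (place X r z) b" using remove_imp_add[OF py b(1)] b(2) by simp
    have "insert b (place X r z) = place X r y" using b by (auto simp: removable_def)
    then have "level X (place X r y) = level X (place X r z) - (if i = 0 then 1 else 0)"
      using add level_add_zero[OF pz, of b] level_add_other[OF pz add] by auto
    then show ?thesis
      using Some e y z by (simp add: e_aff_def explicit_identification_def class_of_wall
        e_cls_column_class py)
  qed
qed

section \<open>The ground state wall\<close>

lemma column_block_filter:
  "column_block X (k, S) \<longleftrightarrow>
     (\<exists>c\<in>set (cell_list X). S = set (filter (\<lambda>d.
        cell_colour (column_pattern X k) d = cell_colour (column_pattern X k) c) (cell_list X)))"
  by (simp add: is_block_iff cells_eq)

lemma block_cases_E6:
  "column_block E6 (1, S) \<Longrightarrow> S = {(1, Upper), (2, Upper), (2, Lower)} \<or> S = {(1, Lower)}"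
  "column_block E6 (2, S) \<Longrightarrow> S = {(1, Upper), (1, Lower)} \<or> S = {(2, Upper), (2, Lower)}"
  "column_block E6 (3, S) \<Longrightarrow> S = {(1, Upper), (1, Lower), (2, Lower)} \<or> S = {(2, Upper)}"
  by (simp_all add: column_block_filter del: set_filter) blast+

lemma block_cases_E7:
  "column_block E7 (1, S) \<Longrightarrow>
     S = {(1, Upper), (2, Upper), (2, Lower)} \<or> S = {(3, Upper), (3, Lower)} \<or> S = {(1, Lower)}"
  "column_block E7 (2, S) \<Longrightarrow>
     S = {(1, Upper), (1, Lower)} \<or> S = {(2, Upper), (2, Lower), (3, Upper), (3, Lower)}"
  "column_block E7 (3, S) \<Longrightarrow>
     S = {(1, Upper), (1, Lower), (2, Lower)} \<or> S = {(2, Upper), (3, Upper), (3, Lower)}"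
  "column_block E7 (4, S) \<Longrightarrow>
     S = {(1, Upper), (1, Lower), (2, Upper), (2, Lower)} \<or> S = {(3, Upper), (3, Lower)}"
  "column_block E7 (5, S) \<Longrightarrow>
     S = {(1, Upper), (1, Lower)} \<or> S = {(2, Upper), (2, Lower), (3, Lower)} \<or> S = {(3, Upper)}"
  by (simp_all add: column_block_filter del: set_filter) blast+

lemma ground_wall_eq: "ground_wall X r = {b. column_block X b \<and> ground_shape X b}"
  by (simp add: ground_wall_def is_block_wall)

lemma ground_shape_cover:
  assumes "cover X b c" "ground_shape X c"
  shows "ground_shape X b"
proof -
  obtain k S T where b: "b = (k, S)" and c: "c = (k + 1, T)"
    using assms(1) by (cases b; cases c) (auto simp: cover_def)
  have bl: "column_block X (k, S)" "column_block X (k + 1, T)" "S \<inter> T \<noteq> {}"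
    using assms(1) b c by (auto simp: cover_def)
  show ?thesis
  proof (cases X)
    case E6
    then consider "k \<le> 0" | "k = 1" "T = {2} \<times> UNIV" | "k = 2" "card T = 1"
      using assms(2) c by auto
    then show ?thesis
    proof cases
      case 1
      then show ?thesis using b E6 by simp
    next
      case 2
      then have "S \<noteq> {(1, Lower)}" using bl(3) by auto
      then show ?thesis using block_cases_E6(1)[of S] bl(1) 2(1) b E6 by auto
    next
      case 3
      then have "T = {(2, Upper)}" using block_cases_E6(3)[of T] bl(2) E6 by auto
      then show ?thesis using block_cases_E6(2)[of S] bl(1,3) 3(1) b E6 by (auto simp: UNIV_row)
    qed
  next
    case E7
    then consider "k \<le> 0" | "k = 1" "T = {2, 3} \<times> UNIV" | "k = 2" "{3} \<times> UNIV \<subseteq> T"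
      | "k = 3" "T = {3} \<times> UNIV" | "k = 4" "card T = 1"
      using assms(2) c by auto
    then show ?thesis
    proof cases
      case 1
      then show ?thesis using b E7 by simp
    next
      case 2
      then have "S \<noteq> {(1, Lower)}" using bl(3) by auto
      then show ?thesis using block_cases_E7(1)[of S] bl(1) 2(1) b E7 by auto
    next
      case 3
      then have "(3, Upper) \<in> T" by blast
      then have "T = {(2, Upper), (3, Upper), (3, Lower)}"
        using block_cases_E7(3)[of T] bl(2) 3(1) E7 by auto
      then show ?thesis using block_cases_E7(2)[of S] bl(1,3) 3(1) b E7 by (auto simp: UNIV_row)
    next
      case 4
      then have "S \<noteq> {(1, Upper), (1, Lower), (2, Lower)}" using bl(3) by auto
      then show ?thesis using block_cases_E7(3)[of S] bl(1) 4(1) b E7 by (auto simp: UNIV_row)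
    next
      case 5
      then have "T = {(3, Upper)}" using block_cases_E7(5)[of T] bl(2) E7 by auto
      then show ?thesis using block_cases_E7(4)[of S] bl(1,3) 5(1) b E7 by (auto simp: UNIV_row)
    qed
  qed
qed

lemma column_ground_wall: "column X (ground_wall X r)"
  unfolding column_iff ground_wall_eq
proof (intro conjI)
  obtain b where b: "cover X b (base X)" using exists_covered[OF colour_block_is_block[OF base]] .
  then have "fst b = 0" by (simp add: cover_def base_def)
  then have "ground_shape X b" by (cases X; cases b) auto
  then show "{b. column_block X b \<and> ground_shape X b} \<noteq> {}" using b by (auto simp: cover_def)
  have "fst b \<le> 5" if "ground_shape X b" for b using that by (cases X; cases b) auto
  then show "\<exists>h. \<forall>b\<in>{b. column_block X b \<and> ground_shape X b}. fst b \<le> h" by blast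
  show "\<forall>b c. cover X b c \<and> c \<in> {b. column_block X b \<and> ground_shape X b} \<longrightarrow>
      b \<in> {b. column_block X b \<and> ground_shape X b}"
  proof (intro allI impI)
    fix b c assume "cover X b c \<and> c \<in> {b. column_block X b \<and> ground_shape X b}"
    then show "b \<in> {b. column_block X b \<and> ground_shape X b}"
      using ground_shape_cover[of X b c] by (simp add: cover_def)
  qed
qed blast

text \<open>The topmost block of a ground state column, the one-cell block of cube
  \<open>lift X + 1\<close>, is the image under \<sigma> of the one-cell block of cube 1, which that
  column omits.\<close>

lemma ground_wall_not_lift: "\<not> ground_wall X r \<subseteq> lift_block X ` ground_wall X r"
proof -
  have "\<exists>S j. column_block X (int (lift X) + 1, S) \<and> ground_shape X (int (lift X) + 1, S) \<and> S =
    {(j, Upper)} \<and>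
      turn_cell X (j, Upper) = (1, Lower)"
  proof (cases X)
    case E6
    have "column_block E6 (3, {(2, Upper)})"
      unfolding is_block_iff by (rule bexI[of _ "(2, Upper)"]) (auto simp: cells_eq)
    then show ?thesis using E6 by auto
  next
    case E7
    have "column_block E7 (5, {(3, Upper)})"
      unfolding is_block_iff by (rule bexI[of _ "(3, Upper)"]) (auto simp: cells_eq)
    then show ?thesis using E7 by auto
  qed
  then obtain S j where S: "(int (lift X) + 1, S) \<in> ground_wall X r" "S = {(j, Upper)}"
      "turn_cell X (j, Upper) = (1, Lower)"
    by (auto simp: ground_wall_eq)
  have "(int (lift X) + 1, S) \<notin> lift_block X ` ground_wall X r"
  proof
    assume "(int (lift X) + 1, S) \<in> lift_block X ` ground_wall X r"
    then obtain d where d: "d \<in> ground_wall X r" "(int (lift X) + 1, S) = lift_block X d" by blast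
    have "snd d \<subseteq> cells X" using column_cells[OF column_ground_wall d(1)] .
    then have "snd d = turn_cell X ` S"
      using d(2) turn_image_turn_image by (auto simp: move_block_def)
    then have "d = (1, {(1, Lower)})" using d(2) S by (cases d) (auto simp: move_block_def)
    then have "ground_shape X (1, {(1, Lower)})" using d(1) by (simp add: ground_wall_eq)
    then show False by (cases X) auto
  qed
  with S(1) show ?thesis by blast
qed

text \<open>The value at the ground state wall is prescribed, and the operators transport agreement
  along the removal of single blocks in either direction; so \<open>y\<close> is linked to the
  ground state column through their intersection.\<close>

lemma identifications_agree:
  assumes \<phi>: "is_identification X r \<phi>" and \<psi>: "is_identification X r \<psi>" and y: "column X y"
  shows "\<phi> y = \<psi> y"
proof -
  have step: "\<phi> y = \<psi> y \<longleftrightarrow> \<phi> (y - {x}) = \<psi> (y - {x})"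
    if y: "column X y" and x: "removable X (wall_pattern X r) i y x" for y i x
  proof
    note facts = removable_wall[OF y x]
    have y': "column X (y - {x})" using x by (simp add: removable_def young_column_wall)
    have 1: "map_option \<theta> (e_col X (wall_pattern X r) i y) = e_aff X i (\<theta> y)"
      "map_option \<theta> (f_col X (wall_pattern X r) i (y - {x})) = f_aff X i (\<theta> (y - {x}))"
      if "is_identification X r \<theta>" for \<theta>
      using that facts(3) y y' unfolding is_identification_def young_column_wall by blast+
    show "\<phi> (y - {x}) = \<psi> (y - {x})" if "\<phi> y = \<psi> y"
      using 1(1)[OF \<phi>] 1(1)[OF \<psi>] that facts(1) by (metis option.inject option.simps(9))
    show "\<phi> y = \<psi> y" if "\<phi> (y - {x}) = \<psi> (y - {x})"
      using 1(2)[OF \<phi>] 1(2)[OF \<psi>] that facts(2) by (metis option.inject option.simps(9))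
  qed
  have sub: "\<phi> y = \<psi> y \<longleftrightarrow> \<phi> u = \<psi> u" if "column X y" "column X u" "u \<subseteq> y" for y u
    using that
  proof (induction "card (y - u)" arbitrary: y rule: less_induct)
    case less
    show ?case
    proof (cases "u = y")
      case False
      then have "u \<subset> y" using less.prems(3) by blast
      then obtain j x where x: "remove_block X j y x" "x \<notin> u"
        using exists_remove_diff[OF less.prems(1,2)] by blast
      have xy: "x \<in> y" "column X (y - {x})" using x by (auto simp: removable_def)
      \<comment> \<open>The same position is removable in both patterns, but its colour depends on
        the column and is looked up again in the wall pattern.\<close>
      obtain i where "is_colour_block X (wall_pattern X r) i x"
        using is_block_wall column_block_in[OF less.prems(1) xy(1)] unfolding is_block_def by metis
      then have "removable X (wall_pattern X r) i y x"
        using xy by (simp add: removable_def young_column_wall)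
      then have "\<phi> y = \<psi> y \<longleftrightarrow> \<phi> (y - {x}) = \<psi> (y - {x})" by (rule step[OF less.prems(1)])
      also have "\<dots> \<longleftrightarrow> \<phi> u = \<psi> u"
      proof (rule less.hyps)
        have "y - {x} - u = y - u - {x}" by blast
        then show "card (y - {x} - u) < card (y - u)"
          using card_Diff1_less[OF finite_column_diff[OF less.prems(1,2)], of x] x xy by simp
      qed (use less.prems xy x in auto)
      finally show ?thesis .
    qed simp
  qed
  let ?g = "ground_wall X r"
  have g: "column X ?g" by (rule column_ground_wall)
  \<comment> \<open>The intersection is non-empty because both columns contain all blocks of small
    height.\<close>
  have u: "column X (y \<inter> ?g)"
  proof -
    obtain k where k: "\<And>b. column_block X b \<Longrightarrow> fst b \<le> k \<Longrightarrow> b \<in> y" using column_low[OF y] by blast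
    obtain l where l: "\<And>b. column_block X b \<Longrightarrow> fst b \<le> l \<Longrightarrow> b \<in> ?g" using column_low[OF g] by blast
    obtain c :: cell where "c \<in> cells X" by (cases X) (auto simp: cells_eq)
    then have "column_block X (min k l, {d \<in> cells X. cell_colour (column_pattern X (min k l)) d =
        cell_colour (column_pattern X (min k l)) c})"
      unfolding is_block_iff by blast
    then have "y \<inter> ?g \<noteq> {}"
      using k l by (metis Int_iff empty_iff fst_conv min.cobounded1 min.cobounded2)
    then show ?thesis using y g unfolding column_iff by blast
  qed
  have "\<phi> ?g = \<psi> ?g" using \<phi> \<psi> by (simp add: is_identification_def)
  then show ?thesis using sub[OF y u] sub[OF g u] by blast
qed

lemma identification_eq:
  assumes "column X y"
  shows "identification X r y = explicit_identification X r y"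
proof (rule identifications_agree[OF _ is_identification_explicit assms])
  show "is_identification X r (identification X r)"
    unfolding identification_def by (rule someI[of "is_identification X r", OF
      is_identification_explicit])
qed

text \<open>The levels cancel against the exponents, and those of the ground state wall against the
  recursion in \<open>ground_height\<close>. What remains compares the offset with that of the
  ground state wall, whose affine energy is 1.\<close>

lemma energy_aff_identification:
  assumes y': "column X y'" and y: "column X y"
  shows "energy_aff X (identification X (Suc r) y') (identification X r y) =
    1 + offset X (place X (Suc r) y') (place X r y)
      - offset X (place X (Suc r) (ground_wall X (Suc r))) (place X r (ground_wall X r))"
  by (simp add: identification_eq y y' energy_aff_def explicit_identification_def class_of_wall
      energy_column_class column_place ground_class_def column_ground_wall)

lemma ground_wall_const: "ground_wall X r = ground_wall X s"
  by (simp add: ground_wall_eq)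

lemma subset_lift:
  assumes y: "column X y" and y': "column X y'" and b: "b \<in> y'" "b \<notin> y"
  shows "y \<subseteq> lift_block X ` y'"
proof
  fix c assume c: "c \<in> y"
  let ?d = "move_block X (inverse_motion (int (lift X), True)) c"
  have cc: "snd c \<subseteq> cells X" using column_cells[OF y c] .
  have d: "lift_block X ?d = c" using cc by (rule move_inverse(2))
  have "column_block X ?d"
    using column_block_lift[of ?d X] move_cells[OF cc] d column_block_in[OF y c] by metis
  from below_lift[OF column_block_in[OF y' b(1)] this]
  have "below X b c \<or> below X ?d b" using d by simp
  \<comment> \<open>If \<open>b\<close> were below \<open>c\<close>, it would lie in
    \<open>y\<close>; so \<open>?d\<close> is below \<open>b\<close>.\<close>
  then have "?d \<in> y'"
    using column_below[OF _ y c] column_below[OF _ y' b(1)] b(2) by blast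
  then show "c \<in> lift_block X ` y'" using d by (metis imageI)
qed

theorem proposition5p7:
  fixes X :: affine_type and Y :: wall
  assumes "Y \<in> Z_Lambda0 X"
  shows "right_block_property Y"
  unfolding right_block_property_def
proof (intro allI impI)
  fix r b assume b: "b \<in> Y (Suc r)"
  have col: "column X (Y s)" for s
    using assms by (simp add: Z_Lambda0_def young_wall_def young_column_wall)
  have pos: "offset X (place X (Suc r) (ground_wall X (Suc r))) (place X r (ground_wall X r))
      \<le> offset X (place X (Suc r) (Y (Suc r))) (place X r (Y r))"
  proof -
    have "energy_aff X (identification X (Suc r) (Y (Suc r))) (identification X r (Y r)) > 0"
      using assms by (simp add: Z_Lambda0_def)
    then show ?thesis using energy_aff_identification[OF col col] by simp
  qed
  show "b \<in> Y r"
  proof (rule ccontr)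
    assume "b \<notin> Y r"
    then have "Y r \<subseteq> lift_block X ` Y (Suc r)" by (rule subset_lift[OF col col b])
    then have "place X r (Y r) \<subseteq> shift X (lag X) (place X (Suc r) (Y (Suc r)))"
      unfolding shift_place_Suc[OF col] by (auto simp: place_def)
    then have "offset X (place X (Suc r) (Y (Suc r))) (place X r (Y r)) \<le> lag X"
      using offset_le_iff column_place col by blast
    \<comment> \<open>Positive energy says that the ground state wall has the smaller or equal
      offset, so it inherits the bound \<open>lag X\<close>; by \<open>shift_place_Suc\<close> this
      means inclusion in its own image under \<sigma>.\<close>
    with pos have "offset X (place X (Suc r) (ground_wall X (Suc r))) (place X r (ground_wall X
      r)) \<le> lag X"
      by linarith
    then have "place X r (ground_wall X r) \<subseteq> place X r (lift_block X ` ground_wall X (Suc r))"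
      using offset_le_iff[OF column_place column_place] column_ground_wall
        shift_place_Suc[OF column_ground_wall] by metis
    then have "ground_wall X r \<subseteq> lift_block X ` ground_wall X r"
      using place_subset_iff[of "ground_wall X r" "lift_block X ` ground_wall X (Suc r)" X r]
        column_cells[OF column_ground_wall] move_cells ground_wall_const[of X r "Suc r"] by blast
    then show False using ground_wall_not_lift by blast
  qed
qed

end
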